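(* Let $T$ be a bounded linear operator on a complex Hilbert space $\mathcal H$. Then: (i) if $1\leq \rho_1\leq \rho_2<+\infty$ and $0\in W^{\rho_1}(T)$, then $W^{\rho_2}(T)\subseteq W^{\rho_1}(T)$; (ii) if $1\leq \rho_1\leq \rho_2<+\infty$ and $0\in\mathrm{Int}\, W^{\rho_2}(T)$, then $W^{\rho_2}(T)\subseteq W^{\rho_1}(T)$; (iii) if $\mathcal H$ is finite dimensional, $1\leq \rho_1< \rho_2 < 2$ and $0\in\mathrm{Int}\, W(T)$, then $W^{\rho_2}(T)\subsetneq W^{\rho_1}(T)$; (iv) the function $\rho\mapsto W^\rho(T)$ is continuous on $[1,2]$ with respect to the Hausdorff metric on compact subsets of $\mathbb C$.
   Context: $W(T)=\{\langle Th,h\rangle:\|h\|=1\}$ is the numerical range; $\mathrm{Int}$ denotes interior in $\mathbb C$. Let $\mathcal H\neq\{0\}$ be a complex Hilbert space, $T$ a bounded linear operator on $\mathcal H$, $\rho\in[1,+\infty)$ and $r=2(1-\frac1\rho)\in[0,2)$. For $h\in\mathcal H$ with $\|h\|=1$ put $\Delta_\rho(h)=r^2|\langle Th,h\rangle|^2-4(r-1)\|Th\|^2$. For $\rho\ne 2$ let $\mathrm{dom}(\xi_\rho)=\{h\in\mathcal H:\|h\|=1,\ (\Delta_\rho(h)>0\text{ or }Th=0)\}$, and let $\mathrm{dom}(\xi_2)=\{h\in\mathcal H:\|h\|=1\}$. For $h\in\mathrm{dom}(\xi_\rho)$ let $\xi_\rho(h)=\frac12\Big(r+\frac{\sqrt{\Delta_\rho(h)}}{|\langle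 Th,h\rangle|}\Big)$ if $\langle Th,h\rangle\ne0$ and $\xi_\rho(h)=1$ if $\langle Th,h\rangle=0$. The deformed numerical range of $T$ is $W^\rho(T)=\mathrm{conv}\,\overline{\{\xi_\rho(h)\langle Th,h\rangle: h\in\mathrm{dom}(\xi_\rho)\}}$. *)

theory Defs
  imports "HOL-Analysis.Analysis"
begin

text \<open>
  Built on top of the real inner product spaces of the library, so that norm, topology and
  completeness are the library ones.  The real inner product is the real part of the complex one;
  positive definiteness and \<open>cinner x x = norm x ^ 2\<close> are inherited from it.
  The complex inner product is linear in its first argument.
\<close>

class complex_inner = real_inner +
  fixes scaleC :: "complex \<Rightarrow> 'a \<Rightarrow> 'a" (infixr \<open>*\<^sub>C\<close> 75)
    and cinner :: "'a \<Rightarrow> 'a \<Rightarrow> complex"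
  assumes scaleC_add_right: "c *\<^sub>C (x + y) = c *\<^sub>C x + c *\<^sub>C y"
    and scaleC_add_left: "(c + d) *\<^sub>C x = c *\<^sub>C x + d *\<^sub>C x"
    and scaleC_scaleC: "c *\<^sub>C d *\<^sub>C x = (c * d) *\<^sub>C x"
    and scaleC_one: "1 *\<^sub>C x = x"
    and scaleR_scaleC: "scaleR a x = complex_of_real a *\<^sub>C x"
    and cinner_commute: "cinner x y = cnj (cinner y x)"
    and cinner_add_left: "cinner (x + y) z = cinner x z + cinner y z"
    and cinner_scaleC_left: "cinner (c *\<^sub>C x) y = c * cinner x y"
    and inner_eq_Re_cinner: "inner x y = Re (cinner x y)"

class complex_hilbert_space = complex_inner + complete_space

lemma vector_space_scaleC:
  "vector_space (scaleC :: complex \<Rightarrow> 'a \<Rightarrow> 'a::complex_inner)"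
  by unfold_locales
    (simp_all add: scaleC_add_right scaleC_add_left scaleC_scaleC scaleC_one)

lemma cinner_self:
  fixes x :: "'a::complex_inner"
  shows "cinner x x = complex_of_real ((norm x)\<^sup>2)"
proof (rule complex_eqI)
  show "Re (cinner x x) = Re (complex_of_real ((norm x)\<^sup>2))"
    by (simp add: inner_eq_Re_cinner[symmetric] power2_norm_eq_inner)
  have "Im (cinner x x) = - Im (cinner x x)"
    by (metis cinner_commute cnj.simps(2))
  then show "Im (cinner x x) = Im (complex_of_real ((norm x)\<^sup>2))" by simp
qed

instantiation complex :: complex_hilbert_space
begin

definition scaleC_complex :: "complex \<Rightarrow> complex \<Rightarrow> complex" where
  "scaleC_complex c x = c * x"

definition cinner_complex :: "complex \<Rightarrow> complex \<Rightarrow> complex" where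
  "cinner_complex x y = x * cnj y"

instance
  by intro_classes
    (auto simp: scaleC_complex_def cinner_complex_def algebra_simps scaleR_conv_of_real
      inner_complex_def)

end

definition bounded_clinear :: "('a::complex_inner \<Rightarrow> 'b::complex_inner) \<Rightarrow> bool" where
  "bounded_clinear T \<longleftrightarrow> Vector_Spaces.linear scaleC scaleC T \<and> bounded_linear T"

definition numerical_range :: "('a::complex_inner \<Rightarrow> 'a) \<Rightarrow> complex set" where
  "numerical_range T = {cinner (T h) h |h. norm h = 1}"

definition def_radius :: "real \<Rightarrow> real" where
  "def_radius \<rho> = 2 * (1 - 1 / \<rho>)"

definition def_discr :: "real \<Rightarrow> ('a::complex_inner \<Rightarrow> 'a) \<Rightarrow> 'a \<Rightarrow> real" where
  "def_discr \<rho> T h =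
     (def_radius \<rho>)\<^sup>2 * (cmod (cinner (T h) h))\<^sup>2 - 4 * (def_radius \<rho> - 1) * (norm (T h))\<^sup>2"

definition def_dom :: "real \<Rightarrow> ('a::complex_inner \<Rightarrow> 'a) \<Rightarrow> 'a set" where
  "def_dom \<rho> T =
     (if \<rho> = 2 then {h. norm h = 1}
      else {h. norm h = 1 \<and> (def_discr \<rho> T h > 0 \<or> T h = 0)})"

definition def_factor :: "real \<Rightarrow> ('a::complex_inner \<Rightarrow> 'a) \<Rightarrow> 'a \<Rightarrow> real" where
  "def_factor \<rho> T h =
     (if cinner (T h) h \<noteq> 0
      then (def_radius \<rho> + sqrt (def_discr \<rho> T h) / cmod (cinner (T h) h)) / 2
      else 1)"

definition deformed_numerical_range ::
    "real \<Rightarrow> ('a::complex_inner \<Rightarrow> 'a) \<Rightarrow> complex set" where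
  "deformed_numerical_range \<rho> T =
     convex hull (closure {complex_of_real (def_factor \<rho> T h) * cinner (T h) h |h. h \<in> def_dom \<rho> T})"

definition nonempty_compacts :: "'a::metric_space set set" where
  "nonempty_compacts = {K. compact K \<and> K \<noteq> {}}"

text \<open>
  The value 0 on empty or unbounded sets is a convention: the library locale
  \<^locale>\<open>Metric_space\<close> asks for a nonnegative distance on the whole type, not only on the carrier.
\<close>

definition hausdorff_dist :: "'a::metric_space set \<Rightarrow> 'a set \<Rightarrow> real" where
  "hausdorff_dist A B =
     (if A \<noteq> {} \<and> B \<noteq> {} \<and> bounded A \<and> bounded B
      then max (SUP a\<in>A. infdist a B) (SUP b\<in>B. infdist b A) else 0)"

lemma hausdorff_dist_le_iff:
  assumes "A \<in> nonempty_compacts" "B \<in> nonempty_compacts"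
  shows "hausdorff_dist A B \<le> e \<longleftrightarrow> (\<forall>a\<in>A. infdist a B \<le> e) \<and> (\<forall>b\<in>B. infdist b A \<le> e)"
proof -
  have bdd: "bdd_above ((\<lambda>x. infdist x Y) ` X)" if "compact X" for X Y :: "'a set"
    using that
    by (intro bounded_imp_bdd_above compact_imp_bounded compact_continuous_image)
      (auto intro!: continuous_intros)
  show ?thesis
    using assms bdd[of A B] bdd[of B A]
    by (simp add: hausdorff_dist_def nonempty_compacts_def cSUP_le_iff compact_imp_bounded)
qed

lemma Metric_space_hausdorff_dist:
  "Metric_space (nonempty_compacts :: 'a::metric_space set set) hausdorff_dist"
proof
  show comm: "hausdorff_dist A B = hausdorff_dist B A" for A B :: "'a set"
    by (auto simp: hausdorff_dist_def max.commute)
  have le: "hausdorff_dist A B \<le> e \<longleftrightarrow> (\<forall>a\<in>A. infdist a B \<le> e) \<and> (\<forall>b\<in>B. infdist b A \<le> e)"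
    if "A \<in> nonempty_compacts" "B \<in> nonempty_compacts" for A B :: "'a set" and e
    using that by (rule hausdorff_dist_le_iff)
  show "0 \<le> hausdorff_dist A B" for A B :: "'a set"
  proof (cases "A \<noteq> {} \<and> B \<noteq> {} \<and> bounded A \<and> bounded B")
    case True
    then obtain a b where a: "a \<in> A" and b: "b \<in> B" by blast
    from True obtain e where e: "\<And>x. x \<in> A \<Longrightarrow> dist x b \<le> e"
      using bounded_any_center[of A b] by (metis dist_commute)
    have "infdist x B \<le> e" if "x \<in> A" for x
      using infdist_le[OF b, of x] e[OF that] by linarith
    then have "bdd_above ((\<lambda>x. infdist x B) ` A)"
      by (auto intro!: bdd_aboveI[of _ e])
    from cSUP_upper[OF a this] have "0 \<le> (SUP x\<in>A. infdist x B)"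
      using infdist_nonneg[of a B] by linarith
    with True show ?thesis by (simp add: hausdorff_dist_def)
  qed (auto simp: hausdorff_dist_def)
  note nonneg = this
  show "hausdorff_dist A B = 0 \<longleftrightarrow> A = B"
    if A: "A \<in> nonempty_compacts" and B: "B \<in> nonempty_compacts" for A B :: "'a set"
  proof -
    have cl: "closed A" "closed B" "A \<noteq> {}" "B \<noteq> {}"
      using A B by (auto simp: nonempty_compacts_def compact_imp_closed)
    have "hausdorff_dist A B = 0 \<longleftrightarrow> hausdorff_dist A B \<le> 0"
      using nonneg[of A B] by linarith
    also have "\<dots> \<longleftrightarrow> (\<forall>a\<in>A. infdist a B = 0) \<and> (\<forall>b\<in>B. infdist b A = 0)"
      unfolding le[OF A B] by (simp add: order_antisym_conv infdist_nonneg)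
    also have "\<dots> \<longleftrightarrow> A \<subseteq> B \<and> B \<subseteq> A"
      using in_closed_iff_infdist_zero[OF cl(1,3)] in_closed_iff_infdist_zero[OF cl(2,4)] by blast
    finally show ?thesis by blast
  qed
  have tri: "infdist a C \<le> hausdorff_dist A B + hausdorff_dist B C"
    if A: "A \<in> nonempty_compacts" and B: "B \<in> nonempty_compacts" and C: "C \<in> nonempty_compacts"
      and a: "a \<in> A" for A B C :: "'a set" and a
  proof -
    have "infdist a C - hausdorff_dist B C \<le> dist a b" if "b \<in> B" for b
      using infdist_triangle[of a C b] le[OF B C, of "hausdorff_dist B C"] that by fastforce
    moreover have "B \<noteq> {}" using B by (simp add: nonempty_compacts_def)
    ultimately have "infdist a C - hausdorff_dist B C \<le> infdist a B"
      by (simp add: infdist_notempty le_cINF_iff)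
    moreover have "infdist a B \<le> hausdorff_dist A B"
      using le[OF A B, of "hausdorff_dist A B"] a by blast
    ultimately show ?thesis by linarith
  qed
  show "hausdorff_dist A C \<le> hausdorff_dist A B + hausdorff_dist B C"
    if A: "A \<in> nonempty_compacts" and B: "B \<in> nonempty_compacts" and C: "C \<in> nonempty_compacts"
    for A B C :: "'a set"
    unfolding le[OF A C]
    using tri[OF A B C] tri[OF C B A] by (simp add: comm add.commute)
qed

end

theory Submission
  imports Defs
begin

text \<open>
  With \<open>a = \<bar>\<langle>Th,h\<rangle>\<bar>\<close> and \<open>t = \<parallel>Th\<parallel>\<close>, the point of \<open>W\<^bsup>\<rho>\<^esup>(T)\<close> coming from \<open>h\<close> lies on the ray of
  \<open>\<langle>Th,h\<rangle>\<close> at a distance which is the larger root of \<open>x\<^sup>2 - r a x + (r - 1) t\<^sup>2\<close>. This root decreases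
  in \<open>r\<close>, strictly if \<open>a < t\<close>. So every point for \<open>\<rho>\<^sub>2\<close> is a multiple, with factor in \<open>[0,1]\<close>, of the
  point for \<open>\<rho>\<^sub>1\<close>, which gives (i) by convexity; in (ii), a line separating \<open>0\<close> from the range for
  \<open>\<rho>\<^sub>1\<close> would confine the range for \<open>\<rho>\<^sub>2\<close> to a half plane with \<open>0\<close> on its boundary. For (iv), when
  \<open>\<rho> \<le> 2\<close> the root is continuous in \<open>r\<close> uniformly in \<open>h\<close>. In (iii), if the two ranges agreed,
  every support line would pass through an eigenvalue whose eigenvector is orthogonal to those of the
  other eigenvalues, and through only one of them, since otherwise \<open>a < t\<close> for the mean of two
  orthogonal eigenvectors; finitely many eigenvalues cannot support all directions in this way.
\<close>

subsection \<open>Complex inner products\<close>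

lemma cinner_add_right: "cinner x (y + z) = cinner x y + cinner x z"
  by (metis cinner_add_left cinner_commute complex_cnj_add)

lemma cinner_scaleC_right: "cinner x (c *\<^sub>C y) = cnj c * cinner x y"
  by (metis cinner_commute cinner_scaleC_left complex_cnj_mult)

lemma norm_scaleC: "norm (c *\<^sub>C x) = cmod c * norm (x :: 'a::complex_inner)"
proof -
  have "complex_of_real ((norm (c *\<^sub>C x))\<^sup>2) = complex_of_real ((cmod c * norm x)\<^sup>2)"
    unfolding cinner_self[symmetric] cinner_scaleC_left cinner_scaleC_right
    by (simp add: cinner_self power_mult_distrib complex_norm_square mult.commute del: of_real_power)
  then show ?thesis
    by (metis norm_ge_zero of_real_eq_iff power2_eq_imp_eq norm_mult norm_of_real zero_le_mult_iff abs_ge_zero)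
qed

text \<open>The phase conjugate to \<open>sgn z\<close> turns \<open>z\<close> into its modulus. In
  this way the complex Cauchy-Schwarz inequality follows from the real one.\<close>

lemma complex_norm_le_phase:
  assumes "\<And>c. cmod c = 1 \<Longrightarrow> Re (c * z) \<le> b"
  shows "cmod z \<le> b"
proof (cases "z = 0")
  case True
  with assms[of 1] show ?thesis by simp
next
  case False
  have "cnj (sgn z) * z = of_real (cmod z)"
    using False by (simp add: sgn_eq complex_norm_square[symmetric] power2_eq_square mult.commute divide_simps)
  with assms[of "cnj (sgn z)"] False show ?thesis by (simp add: norm_sgn)
qed

lemma cinner_Cauchy_Schwarz: "cmod (cinner x y) \<le> norm x * norm (y :: 'a::complex_inner)"
proof (rule complex_norm_le_phase)
  fix c :: complex assume "cmod c = 1"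
  then show "Re (c * cinner x y) \<le> norm x * norm y"
    using norm_cauchy_schwarz[of "c *\<^sub>C x" y]
    by (simp add: inner_eq_Re_cinner cinner_scaleC_left norm_scaleC)
qed

text \<open>Over the reals the sesquilinear form is bilinear, so the general facts on bounded
  bilinear maps give its continuity and its behaviour under sums.\<close>

lemma bounded_bilinear_cinner: "bounded_bilinear (cinner :: 'a::complex_inner \<Rightarrow> 'a \<Rightarrow> complex)"
proof
  show "\<exists>K. \<forall>x y :: 'a. cmod (cinner x y) \<le> norm x * norm y * K"
    using cinner_Cauchy_Schwarz by (metis mult.right_neutral)
qed (simp_all add: cinner_add_left cinner_add_right scaleR_scaleC cinner_scaleC_left cinner_scaleC_right
      scaleC_complex_def)

interpretation cinner: bounded_bilinear "cinner :: 'a::complex_inner \<Rightarrow> 'a \<Rightarrow> complex"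
  by (rule bounded_bilinear_cinner)

lemma bounded_bilinear_scaleC:
  "bounded_bilinear (scaleC :: complex \<Rightarrow> 'a \<Rightarrow> 'a::complex_inner)"
proof
  show "\<exists>K. \<forall>c (x :: 'a). norm (c *\<^sub>C x) \<le> cmod c * norm x * K"
    by (metis mult.right_neutral norm_scaleC order_refl)
qed (simp_all add: scaleC_add_left scaleC_add_right scaleR_scaleC scaleC_scaleC scaleC_complex_def mult.commute)

interpretation scaleC: bounded_bilinear "scaleC :: complex \<Rightarrow> 'a \<Rightarrow> 'a::complex_inner"
  by (rule bounded_bilinear_scaleC)

lemma cinner_self_eq_1: "norm h = 1 \<Longrightarrow> cinner h h = 1"
  by (simp add: cinner_self)

lemma bounded_clinear_scaleC: "bounded_clinear T \<Longrightarrow> T (c *\<^sub>C x) = c *\<^sub>C T x"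
  unfolding bounded_clinear_def by (metis linear_iff_module_hom module_hom.scale)

lemma bounded_clinear_add: "bounded_clinear T \<Longrightarrow> T (x + y) = T x + T y"
  unfolding bounded_clinear_def by (metis linear_iff_module_hom module_hom.add)

lemma cmod_cinner_le_norm: "norm h = 1 \<Longrightarrow> cmod (cinner (T h) h) \<le> norm (T h)"
  using cinner_Cauchy_Schwarz[of "T h" h] by simp

subsection \<open>The radius of a deformed point\<close>

text \<open>
  The larger root of \<open>x\<^sup>2 - r a x + (r - 1) t\<^sup>2\<close>; for \<open>a = \<bar>\<langle>Th,h\<rangle>\<bar>\<close> and \<open>t = \<parallel>Th\<parallel>\<close> it is the modulus
  of \<open>\<xi>\<^sub>\<rho>(h) \<langle>Th,h\<rangle>\<close> if \<open>a \<noteq> 0\<close>. If \<open>a = 0\<close> that point is \<open>0\<close>, but the root need not vanish; the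
  factor \<open>sgn 0 = 0\<close> in \<open>deformed_point\<close> takes care of this case.
\<close>

definition larger_root :: "real \<Rightarrow> real \<Rightarrow> real \<Rightarrow> real" where
  "larger_root r a t = (r * a + sqrt (r\<^sup>2 * a\<^sup>2 - 4 * (r - 1) * t\<^sup>2)) / 2"

lemma larger_root_equation:
  assumes "0 \<le> r\<^sup>2 * a\<^sup>2 - 4 * (r - 1) * t\<^sup>2"
  shows "(larger_root r a t)\<^sup>2 - r * a * larger_root r a t + (r - 1) * t\<^sup>2 = 0"
proof -
  have "(sqrt (r\<^sup>2 * a\<^sup>2 - 4 * (r - 1) * t\<^sup>2))\<^sup>2 = r\<^sup>2 * a\<^sup>2 - 4 * (r - 1) * t\<^sup>2"
    using assms by simp
  then show ?thesis by (simp add: larger_root_def power2_eq_square field_simps)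
qed

lemma larger_root_nonneg:
  assumes "0 \<le> r" "0 \<le> a" "0 \<le> r\<^sup>2 * a\<^sup>2 - 4 * (r - 1) * t\<^sup>2"
  shows "0 \<le> larger_root r a t"
  using assms by (simp add: larger_root_def)

text \<open>At \<open>x = t\<close> the quadratic has the nonnegative value r t (t - a), and
  \<open>t\<close> lies to the right of the vertex r a / 2.\<close>

lemma larger_root_le:
  assumes "0 \<le> r" "r \<le> 2" "0 \<le> a" "a \<le> t"
  shows "larger_root r a t \<le> t"
proof -
  have ra: "r * a \<le> 2 * t" using mult_mono[of r 2 a t] assms by simp
  have "r * a * t \<le> r * t * t" using assms by (intro mult_right_mono mult_left_mono) auto
  then have "r\<^sup>2 * a\<^sup>2 - 4 * (r - 1) * t\<^sup>2 \<le> (2 * t - r * a)\<^sup>2"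
    by (simp add: power2_eq_square algebra_simps)
  then have "sqrt (r\<^sup>2 * a\<^sup>2 - 4 * (r - 1) * t\<^sup>2) \<le> 2 * t - r * a"
    using ra by (intro real_le_lsqrt) auto
  then show ?thesis by (simp add: larger_root_def)
qed

text \<open>The discriminant is a perfect square and the roots are t and (r - 1) t;
  \<open>r \<le> 2\<close> makes the first the larger one.\<close>

lemma larger_root_diagonal: "0 \<le> t \<Longrightarrow> r \<le> 2 \<Longrightarrow> larger_root r t t = t"
proof -
  assume "0 \<le> t" "r \<le> 2"
  then have "sqrt (((2 - r) * t)\<^sup>2) = (2 - r) * t" by simp
  moreover have "r\<^sup>2 * t\<^sup>2 - 4 * (r - 1) * t\<^sup>2 = ((2 - r) * t)\<^sup>2"
    by (simp add: power2_eq_square algebra_simps)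
  ultimately have "larger_root r t t = (r * t + (2 - r) * t) / 2" by (simp only: larger_root_def)
  then show ?thesis by (simp add: algebra_simps)
qed

lemma larger_root_1: "0 \<le> a \<Longrightarrow> larger_root 1 a t = a"
  by (simp add: larger_root_def)

text \<open>Completing the square in the quadratic for \<open>r'\<close> at \<open>x\<close> and
  subtracting the vanishing quadratic for \<open>r\<close> leaves only the last term. Its sign tells
  whether \<open>x\<close> lies between the roots for \<open>r'\<close>.\<close>

lemma square_sub_discriminant:
  fixes x r a t r' :: real
  assumes "x\<^sup>2 - r * a * x + (r - 1) * t\<^sup>2 = 0"
  shows "(2 * x - r' * a)\<^sup>2 = (r'\<^sup>2 * a\<^sup>2 - 4 * (r' - 1) * t\<^sup>2) - 4 * ((r - r') * (t\<^sup>2 - a * x))"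
  using assms by algebra

text \<open>The root \<open>x\<close> for the larger parameter satisfies a x <= t^2, so the
  quadratic for the smaller parameter is nonpositive at \<open>x\<close>.\<close>

lemma larger_root_antimono:
  assumes "0 \<le> r\<^sub>1" "r\<^sub>1 \<le> r\<^sub>2" "r\<^sub>2 \<le> 2" "0 \<le> a" "a \<le> t"
    and "0 \<le> r\<^sub>2\<^sup>2 * a\<^sup>2 - 4 * (r\<^sub>2 - 1) * t\<^sup>2"
  shows "larger_root r\<^sub>2 a t \<le> larger_root r\<^sub>1 a t"
proof -
  let ?x = "larger_root r\<^sub>2 a t"
  have "a * ?x \<le> t * t" using larger_root_le[of r\<^sub>2 a t] larger_root_nonneg[of r\<^sub>2 a t] assms
    by (intro mult_mono) auto
  then have "0 \<le> (r\<^sub>2 - r\<^sub>1) * (t\<^sup>2 - a * ?x)" using assms by (simp add: power2_eq_square)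
  then have "(2 * ?x - r\<^sub>1 * a)\<^sup>2 \<le> r\<^sub>1\<^sup>2 * a\<^sup>2 - 4 * (r\<^sub>1 - 1) * t\<^sup>2"
    using square_sub_discriminant[OF larger_root_equation[OF assms(6)], of r\<^sub>1] by linarith
  then have "2 * ?x - r\<^sub>1 * a \<le> sqrt (r\<^sub>1\<^sup>2 * a\<^sup>2 - 4 * (r\<^sub>1 - 1) * t\<^sup>2)" by (rule real_le_rsqrt)
  then show ?thesis by (simp add: larger_root_def[of r\<^sub>1])
qed

lemma larger_root_strict_antimono:
  assumes "0 \<le> r\<^sub>1" "r\<^sub>1 < r\<^sub>2" "r\<^sub>2 \<le> 2" "0 \<le> a" "a < t"
    and "0 \<le> r\<^sub>2\<^sup>2 * a\<^sup>2 - 4 * (r\<^sub>2 - 1) * t\<^sup>2"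
  shows "larger_root r\<^sub>2 a t < larger_root r\<^sub>1 a t"
proof -
  let ?x = "larger_root r\<^sub>2 a t"
  have "a * ?x \<le> a * t" using larger_root_le[of r\<^sub>2 a t] assms by (intro mult_left_mono) auto
  also have "\<dots> < t * t" using assms by simp
  finally have "0 < (r\<^sub>2 - r\<^sub>1) * (t\<^sup>2 - a * ?x)" using assms by (simp add: power2_eq_square)
  then have "(2 * ?x - r\<^sub>1 * a)\<^sup>2 < r\<^sub>1\<^sup>2 * a\<^sup>2 - 4 * (r\<^sub>1 - 1) * t\<^sup>2"
    using square_sub_discriminant[OF larger_root_equation[OF assms(6)], of r\<^sub>1] by linarith
  then have "2 * ?x - r\<^sub>1 * a < sqrt (r\<^sub>1\<^sup>2 * a\<^sup>2 - 4 * (r\<^sub>1 - 1) * t\<^sup>2)" by (rule real_less_rsqrt)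
  then show ?thesis by (simp add: larger_root_def[of r\<^sub>1])
qed

text \<open>For r > 1 positivity bounds (t / a)^2 by r^2 / (4 (r - 1)), which decreases on (1, 2).
  For r at most 1 both terms contribute nonnegatively.\<close>

lemma discriminant_pos_antimono:
  fixes r\<^sub>1 r\<^sub>2 a t :: real
  assumes "0 \<le> r\<^sub>1" "r\<^sub>1 \<le> r\<^sub>2" "r\<^sub>2 < 2" "0 < a" "a \<le> t"
    and pos: "0 < r\<^sub>2\<^sup>2 * a\<^sup>2 - 4 * (r\<^sub>2 - 1) * t\<^sup>2"
  shows "0 < r\<^sub>1\<^sup>2 * a\<^sup>2 - 4 * (r\<^sub>1 - 1) * t\<^sup>2"
proof (cases "r\<^sub>1 \<le> 1")
  case True
  show ?thesis
  proof (cases "r\<^sub>1 = 1")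
    case False
    then have "0 < (1 - r\<^sub>1) * t\<^sup>2" using True assms by simp
    moreover have "0 \<le> r\<^sub>1\<^sup>2 * a\<^sup>2" by simp
    moreover have "r\<^sub>1\<^sup>2 * a\<^sup>2 - 4 * (r\<^sub>1 - 1) * t\<^sup>2 = r\<^sub>1\<^sup>2 * a\<^sup>2 + 4 * ((1 - r\<^sub>1) * t\<^sup>2)"
      by (simp add: algebra_simps)
    ultimately show ?thesis by linarith
  qed (use assms in simp)
next
  case False
  \<comment> \<open>The decrease of r^2 / (r - 1), with denominators cleared.\<close>
  have "0 \<le> (r\<^sub>2 - r\<^sub>1) * (1 - (r\<^sub>1 - 1) * (r\<^sub>2 - 1))"
    using False assms mult_mono[of "r\<^sub>1 - 1" 1 "r\<^sub>2 - 1" 1] by simp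
  also have "\<dots> = r\<^sub>1\<^sup>2 * (r\<^sub>2 - 1) - r\<^sub>2\<^sup>2 * (r\<^sub>1 - 1)"
    by (simp add: power2_eq_square algebra_simps)
  finally have "r\<^sub>2\<^sup>2 * (r\<^sub>1 - 1) * a\<^sup>2 \<le> r\<^sub>1\<^sup>2 * (r\<^sub>2 - 1) * a\<^sup>2"
    by (intro mult_right_mono) auto
  moreover have "0 < (r\<^sub>1 - 1) * (r\<^sub>2\<^sup>2 * a\<^sup>2 - 4 * (r\<^sub>2 - 1) * t\<^sup>2)"
    using False pos by simp
  ultimately have "0 < (r\<^sub>2 - 1) * (r\<^sub>1\<^sup>2 * a\<^sup>2 - 4 * (r\<^sub>1 - 1) * t\<^sup>2)"
    by (simp add: algebra_simps)
  then show ?thesis using False assms by (simp add: zero_less_mult_iff)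
qed

section \<open>Uniform continuity of the larger root in \<open>r\<close>\<close>

lemma abs_sqrt_diff_le:
  assumes "0 \<le> x" "0 \<le> y"
  shows "\<bar>sqrt x - sqrt y\<bar> \<le> sqrt \<bar>x - y\<bar>"
proof -
  have *: "sqrt u - sqrt v \<le> sqrt \<bar>u - v\<bar>" if "0 \<le> v" for u v :: real
    using sqrt_add_le_add_sqrt[of "\<bar>u - v\<bar>" v] real_sqrt_le_mono[of u "\<bar>u - v\<bar> + v"] that by linarith
  show ?thesis using *[of y x] *[of x y] assms by (simp add: abs_minus_commute abs_le_iff)
qed

text \<open>The second summand is the Hoelder bound for the square root, which survives a vanishing
  discriminant. The bound involves only \<open>B\<close> and the parameters, hence is uniform over
  unit vectors.\<close>

lemma larger_root_modulus_of_continuity: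
  assumes "r \<in> {0..1}" "s \<in> {0..1}" "0 \<le> a" "a \<le> t" "t \<le> B"
  shows "\<bar>larger_root r a t - larger_root s a t\<bar> \<le> \<bar>r - s\<bar> * B + sqrt (6 * \<bar>r - s\<bar>) * B"
proof -
  let ?D = "\<lambda>r. r\<^sup>2 * a\<^sup>2 - 4 * (r - 1) * t\<^sup>2"
  have D: "0 \<le> ?D r" if "r \<in> {0..1}" for r :: real
  proof -
    have "0 \<le> (1 - r) * t\<^sup>2" "0 \<le> r\<^sup>2 * a\<^sup>2" using that by auto
    moreover have "?D r = r\<^sup>2 * a\<^sup>2 + 4 * ((1 - r) * t\<^sup>2)" by (simp add: algebra_simps)
    ultimately show ?thesis by linarith
  qed
  have a: "a\<^sup>2 \<le> B\<^sup>2" "t\<^sup>2 \<le> B\<^sup>2" using assms by (auto intro!: power_mono)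
  have "?D r - ?D s = (r - s) * ((r + s) * a\<^sup>2 - 4 * t\<^sup>2)"
    by (simp add: power2_eq_square algebra_simps)
  \<comment> \<open>The constant is 6 = 2 + 4, from r + s <= 2.\<close>
  moreover have "\<bar>(r + s) * a\<^sup>2 - 4 * t\<^sup>2\<bar> \<le> 6 * B\<^sup>2"
  proof -
    have "(r + s) * a\<^sup>2 \<le> 2 * B\<^sup>2" using assms a by (intro mult_mono) auto
    moreover have "0 \<le> (r + s) * a\<^sup>2" using assms by auto
    ultimately show ?thesis using a zero_le_power2[of t] unfolding abs_le_iff by linarith
  qed
  ultimately have "\<bar>?D r - ?D s\<bar> \<le> 6 * \<bar>r - s\<bar> * B\<^sup>2"
    using mult_left_mono[of _ _ "\<bar>r - s\<bar>"] by (fastforce simp: abs_mult)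
  then have "sqrt \<bar>?D r - ?D s\<bar> \<le> sqrt (6 * \<bar>r - s\<bar> * B\<^sup>2)" by (rule real_sqrt_le_mono)
  then have 1: "\<bar>sqrt (?D r) - sqrt (?D s)\<bar> \<le> sqrt (6 * \<bar>r - s\<bar>) * B"
    using abs_sqrt_diff_le[OF D D, of r s] assms by (simp add: real_sqrt_mult)
  have 2: "\<bar>(r - s) * a\<bar> \<le> \<bar>r - s\<bar> * B"
    using assms by (simp add: abs_mult mult_left_mono)
  have "larger_root r a t - larger_root s a t = ((r - s) * a + (sqrt (?D r) - sqrt (?D s))) / 2"
    by (simp add: larger_root_def field_simps)
  moreover have "\<bar>(u + v) / 2\<bar> \<le> \<bar>u\<bar> + \<bar>v\<bar>" for u v :: real
    using abs_triangle_ineq[of u v] by (simp add: abs_divide)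
  ultimately have "\<bar>larger_root r a t - larger_root s a t\<bar> \<le> \<bar>(r - s) * a\<bar> + \<bar>sqrt (?D r) - sqrt (?D s)\<bar>"
    by metis
  with 1 2 show ?thesis by linarith
qed

subsection \<open>Monotonicity\<close>

lemma def_radius_mono: "1 \<le> \<rho>\<^sub>1 \<Longrightarrow> \<rho>\<^sub>1 \<le> \<rho>\<^sub>2 \<Longrightarrow> def_radius \<rho>\<^sub>1 \<le> def_radius \<rho>\<^sub>2"
  by (simp add: def_radius_def frac_le)

lemma def_radius_strict_mono: "1 \<le> \<rho>\<^sub>1 \<Longrightarrow> \<rho>\<^sub>1 < \<rho>\<^sub>2 \<Longrightarrow> def_radius \<rho>\<^sub>1 < def_radius \<rho>\<^sub>2"
  by (simp add: def_radius_def frac_less2)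

lemma def_radius_bounds: "1 \<le> \<rho> \<Longrightarrow> 0 \<le> def_radius \<rho>" "1 \<le> \<rho> \<Longrightarrow> def_radius \<rho> < 2"
  by (simp_all add: def_radius_def divide_simps)

lemma def_radius_2: "def_radius 2 = 1"
  by (simp add: def_radius_def)

text \<open>Polar form: the direction does not depend on \<open>\<rho>\<close>, so comparing two
  values of \<open>\<rho>\<close> at the same \<open>h\<close> means comparing two real
  numbers.\<close>

definition deformed_point :: "real \<Rightarrow> ('a::complex_inner \<Rightarrow> 'a) \<Rightarrow> 'a \<Rightarrow> complex" where
  "deformed_point \<rho> T h =
     of_real (larger_root (def_radius \<rho>) (cmod (cinner (T h) h)) (norm (T h))) * sgn (cinner (T h) h)"

lemma def_factor_eq_deformed_point:
  "of_real (def_factor \<rho> T h) * cinner (T h) h = deformed_point \<rho> T h"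
  by (simp add: def_factor_def deformed_point_def larger_root_def def_discr_def sgn_eq field_simps)

lemma deformed_numerical_range_eq:
  "deformed_numerical_range \<rho> T = convex hull closure (deformed_point \<rho> T ` def_dom \<rho> T)"
  unfolding deformed_numerical_range_def def_factor_eq_deformed_point
  by (simp add: setcompr_eq_image)

lemma def_domD:
  assumes "h \<in> def_dom \<rho> T" "1 \<le> \<rho>"
  shows "norm h = 1" "0 \<le> def_discr \<rho> T h"
    "cinner (T h) h \<noteq> 0 \<Longrightarrow> 0 < def_discr \<rho> T h"
  using assms by (auto simp: def_dom_def def_discr_def def_radius_2 cinner.zero_left
      split: if_splits)

text \<open>For \<open>\<rho> < 2\<close> the radius is below 1, and the discriminant is a square
  plus a term that is positive unless \<open>T h = 0\<close>, a case the domain admits.\<close>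

lemma def_dom_eq_sphere:
  assumes "\<rho> \<in> {1..2}"
  shows "def_dom \<rho> T = sphere 0 1"
proof (cases "\<rho> = 2")
  case False
  then have "def_radius \<rho> < 1" using def_radius_strict_mono[of \<rho> 2] assms by (simp add: def_radius_2)
  then have "0 < (1 - def_radius \<rho>) * (norm (T h))\<^sup>2" if "T h \<noteq> 0" for h
    using that by simp
  moreover have "def_discr \<rho> T h = (def_radius \<rho> * cmod (cinner (T h) h))\<^sup>2
      + 4 * ((1 - def_radius \<rho>) * (norm (T h))\<^sup>2)" for h
    by (simp add: def_discr_def algebra_simps)
  ultimately have "0 < def_discr \<rho> T h" if "T h \<noteq> 0" for h
    using that by (metis add_nonneg_pos mult_pos_pos zero_le_power2 zero_less_numeral)
  then show ?thesis using False by (auto simp: def_dom_def)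
qed (auto simp: def_dom_def)

lemma norm_deformed_point_le:
  assumes "1 \<le> \<rho>" "h \<in> def_dom \<rho> T"
  shows "cmod (deformed_point \<rho> T h) \<le> norm (T h)"
proof -
  have "0 \<le> larger_root (def_radius \<rho>) (cmod (cinner (T h) h)) (norm (T h))"
    using def_domD(2)[OF assms(2,1)] assms(1)
    by (intro larger_root_nonneg) (auto simp: def_radius_bounds def_discr_def)
  moreover have "larger_root (def_radius \<rho>) (cmod (cinner (T h) h)) (norm (T h)) \<le> norm (T h)"
    using def_radius_bounds[OF assms(1)] cmod_cinner_le_norm[OF def_domD(1)[OF assms(2,1)]]
    by (intro larger_root_le) auto
  ultimately show ?thesis by (simp add: deformed_point_def norm_mult norm_sgn)
qed

lemma bounded_deformed_points:
  assumes "bounded_clinear T" "1 \<le> \<rho>"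
  shows "bounded (deformed_point \<rho> T ` def_dom \<rho> T)"
proof -
  obtain B where "\<And>h. norm (T h) \<le> norm h * B"
    using assms(1) unfolding bounded_clinear_def by (metis bounded_linear.bounded)
  then have "cmod (deformed_point \<rho> T h) \<le> B" if "h \<in> def_dom \<rho> T" for h
    using norm_deformed_point_le[OF assms(2) that] def_domD(1)[OF that assms(2)] by (metis mult_1 order_trans)
  then show ?thesis by (intro boundedI[of _ B]) auto
qed

lemma compact_closure_deformed_points:
  assumes "bounded_clinear T" "1 \<le> \<rho>"
  shows "compact (closure (deformed_point \<rho> T ` def_dom \<rho> T))"
  using bounded_deformed_points[OF assms] by (simp add: compact_closure)

lemma compact_deformed_numerical_range:
  assumes "bounded_clinear T" "1 \<le> \<rho>"
  shows "compact (deformed_numerical_range \<rho> T)"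
  using compact_closure_deformed_points[OF assms]
  by (simp add: deformed_numerical_range_eq compact_convex_hull)

lemma deformed_point_in_range:
  "h \<in> def_dom \<rho> T \<Longrightarrow> deformed_point \<rho> T h \<in> deformed_numerical_range \<rho> T"
  unfolding deformed_numerical_range_eq by (meson closure_subset hull_inc image_eqI subsetD)

lemma convex_deformed_numerical_range: "convex (deformed_numerical_range \<rho> T)"
  by (simp add: deformed_numerical_range_eq)

lemma deformed_numerical_range_subsetI:
  assumes "\<And>h. h \<in> def_dom \<rho> T \<Longrightarrow> deformed_point \<rho> T h \<in> C" "closed C" "convex C"
  shows "deformed_numerical_range \<rho> T \<subseteq> C"
  unfolding deformed_numerical_range_eq
  by (rule hull_minimal[OF closure_minimal]) (use assms in auto)

text \<open>The factor \<open>s\<close> is the quotient of the two larger roots. A nonzero point has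
  <Th,h> nonzero, hence a positive discriminant, which stays positive when \<open>\<rho>\<close>
  decreases.\<close>

lemma deformed_point_shrinks:
  assumes "1 \<le> \<rho>\<^sub>1" "\<rho>\<^sub>1 \<le> \<rho>\<^sub>2" "h \<in> def_dom \<rho>\<^sub>2 T" "deformed_point \<rho>\<^sub>2 T h \<noteq> 0"
  obtains s where "0 \<le> s" "s \<le> 1" "h \<in> def_dom \<rho>\<^sub>1 T"
    "deformed_point \<rho>\<^sub>2 T h = s *\<^sub>R deformed_point \<rho>\<^sub>1 T h"
proof -
  define a where "a = cmod (cinner (T h) h)"
  define t where "t = norm (T h)"
  define x where "x = (\<lambda>\<rho>. larger_root (def_radius \<rho>) a t)"
  have \<rho>2: "1 \<le> \<rho>\<^sub>2" using assms by simp
  have z: "cinner (T h) h \<noteq> 0" using assms(4) by (auto simp: deformed_point_def)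
  have h: "norm h = 1" and D2: "0 < def_discr \<rho>\<^sub>2 T h"
    using def_domD[OF assms(3) \<rho>2] z by auto
  have a: "0 < a" "a \<le> t" using z cmod_cinner_le_norm[OF h, of T] by (auto simp: a_def t_def)
  note r = def_radius_bounds[OF assms(1)] def_radius_bounds[OF \<rho>2] def_radius_mono[OF assms(1,2)]
  have D1: "0 < def_discr \<rho>\<^sub>1 T h"
    unfolding def_discr_def
    by (rule discriminant_pos_antimono[OF r(1,5,4)]) (use a D2 in \<open>auto simp: a_def t_def def_discr_def\<close>)
  have "x \<rho>\<^sub>2 \<le> x \<rho>\<^sub>1" unfolding x_def
    by (rule larger_root_antimono) (use r a D2 in \<open>auto simp: a_def t_def def_discr_def\<close>)
  moreover have "0 \<le> x \<rho>\<^sub>2" unfolding x_def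
    by (rule larger_root_nonneg) (use r a D2 in \<open>auto simp: a_def t_def def_discr_def\<close>)
  moreover have "x \<rho>\<^sub>2 \<noteq> 0" using assms(4) by (auto simp: deformed_point_def x_def a_def t_def)
  ultimately have x: "0 < x \<rho>\<^sub>2" "x \<rho>\<^sub>2 \<le> x \<rho>\<^sub>1" by auto
  have p: "deformed_point \<rho> T h = of_real (x \<rho>) * sgn (cinner (T h) h)" for \<rho>
    by (simp add: deformed_point_def x_def a_def t_def)
  show thesis
  proof
    show "0 \<le> x \<rho>\<^sub>2 / x \<rho>\<^sub>1" "x \<rho>\<^sub>2 / x \<rho>\<^sub>1 \<le> 1" using x by auto
    show "h \<in> def_dom \<rho>\<^sub>1 T" using h D1 by (simp add: def_dom_def)
    show "deformed_point \<rho>\<^sub>2 T h = (x \<rho>\<^sub>2 / x \<rho>\<^sub>1) *\<^sub>R deformed_point \<rho>\<^sub>1 T h"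
      using x by (simp add: p scaleR_conv_of_real)
  qed
qed

lemma deformed_numerical_range_antimono:
  assumes "bounded_clinear T" "1 \<le> \<rho>\<^sub>1" "\<rho>\<^sub>1 \<le> \<rho>\<^sub>2" "0 \<in> deformed_numerical_range \<rho>\<^sub>1 T"
  shows "deformed_numerical_range \<rho>\<^sub>2 T \<subseteq> deformed_numerical_range \<rho>\<^sub>1 T"
proof (rule deformed_numerical_range_subsetI)
  show "closed (deformed_numerical_range \<rho>\<^sub>1 T)"
    using assms by (simp add: compact_deformed_numerical_range compact_imp_closed)
  fix h assume h: "h \<in> def_dom \<rho>\<^sub>2 T"
  show "deformed_point \<rho>\<^sub>2 T h \<in> deformed_numerical_range \<rho>\<^sub>1 T"
  proof (cases "deformed_point \<rho>\<^sub>2 T h = 0")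
    case False
    then obtain s where "0 \<le> s" "s \<le> 1" "h \<in> def_dom \<rho>\<^sub>1 T"
      and "deformed_point \<rho>\<^sub>2 T h = s *\<^sub>R deformed_point \<rho>\<^sub>1 T h"
      using deformed_point_shrinks[OF assms(2,3) h] by metis
    then show ?thesis
      using convexD[OF convex_deformed_numerical_range assms(4) deformed_point_in_range, of h "1 - s" s]
      by simp
  qed (use assms in simp)
qed (rule convex_deformed_numerical_range)

lemma zero_in_deformed_numerical_range:
  assumes "bounded_clinear T" "1 \<le> \<rho>\<^sub>1" "\<rho>\<^sub>1 \<le> \<rho>\<^sub>2" "0 \<in> interior (deformed_numerical_range \<rho>\<^sub>2 T)"
  shows "0 \<in> deformed_numerical_range \<rho>\<^sub>1 T"
proof (rule ccontr)
  assume "0 \<notin> deformed_numerical_range \<rho>\<^sub>1 T"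
  then obtain c b where c: "b > 0" "\<And>w. w \<in> deformed_numerical_range \<rho>\<^sub>1 T \<Longrightarrow> b < inner c w"
    using separating_hyperplane_closed_0[OF convex_deformed_numerical_range]
      compact_imp_closed[OF compact_deformed_numerical_range[OF assms(1,2)]] by metis
  have half: "deformed_numerical_range \<rho>\<^sub>2 T \<subseteq> {w. 0 \<le> inner c w}"
  proof (rule deformed_numerical_range_subsetI)
    fix h assume h: "h \<in> def_dom \<rho>\<^sub>2 T"
    show "deformed_point \<rho>\<^sub>2 T h \<in> {w. 0 \<le> inner c w}"
    proof (cases "deformed_point \<rho>\<^sub>2 T h = 0")
      case False
      then obtain s where "0 \<le> s" "h \<in> def_dom \<rho>\<^sub>1 T"
        and "deformed_point \<rho>\<^sub>2 T h = s *\<^sub>R deformed_point \<rho>\<^sub>1 T h"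
        using deformed_point_shrinks[OF assms(2,3) h] by metis
      then show ?thesis using c(1) c(2)[OF deformed_point_in_range, of h] by simp
    qed simp
  qed (simp_all add: closed_halfspace_ge convex_halfspace_ge)
  \<comment> \<open>A zero normal can separate only if the range for \<open>\<rho>\<^sub>1\<close>
    is empty; then every point for \<open>\<rho>\<^sub>2\<close> is 0, and the range has no
    interior.\<close>
  have "c \<noteq> 0"
  proof
    assume "c = 0"
    then have "deformed_numerical_range \<rho>\<^sub>1 T = {}" using c by force
    moreover have "deformed_numerical_range \<rho>\<^sub>2 T \<subseteq> {0}"
    proof (rule deformed_numerical_range_subsetI)
      fix h assume "h \<in> def_dom \<rho>\<^sub>2 T"
      then show "deformed_point \<rho>\<^sub>2 T h \<in> {0}"
        using deformed_point_shrinks[OF assms(2,3)] deformed_point_in_range calculation by (metis empty_iff singletonI)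
    qed simp_all
    then have "interior (deformed_numerical_range \<rho>\<^sub>2 T) \<subseteq> {}"
      using interior_mono by (metis interior_singleton)
    ultimately show False using assms(4) by blast
  qed
  then have "interior {w. 0 \<le> inner c w} = {w. 0 < inner c w}" using interior_halfspace_ge by blast
  then show False using interior_mono[OF half] assms(4) by auto
qed

subsection \<open>Continuity in the Hausdorff metric\<close>

text \<open>Nearby points of \<open>S\<close> are combined with the same weights. The slack
  \<open>d\<close> is there because the infimum may not be attained.\<close>

lemma convex_infdist_le:
  fixes S :: "'a::real_normed_vector set"
  assumes "convex S" "S \<noteq> {}"
  shows "convex {x. infdist x S \<le> e}"
proof (rule convexI)
  fix x y and u v :: real
  assume "x \<in> {x. infdist x S \<le> e}" "y \<in> {x. infdist x S \<le> e}"
    and uv: "0 \<le> u" "0 \<le> v" "u + v = 1"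
  then have xy: "infdist x S \<le> e" "infdist y S \<le> e" by auto
  have "infdist (u *\<^sub>R x + v *\<^sub>R y) S \<le> e + d" if "d > 0" for d
  proof -
    have "\<exists>p\<in>S. dist w p < e + d" if "infdist w S \<le> e" for w
      using cInf_lessD[of "dist w ` S" "e + d"] \<open>d > 0\<close> that assms(2) by (auto simp: infdist_notempty)
    then obtain p q where pq: "p \<in> S" "dist x p < e + d" "q \<in> S" "dist y q < e + d"
      using xy by meson
    have "norm (u *\<^sub>R x + v *\<^sub>R y - (u *\<^sub>R p + v *\<^sub>R q)) = norm (u *\<^sub>R (x - p) + v *\<^sub>R (y - q))"
      by (simp add: algebra_simps)
    also have "\<dots> \<le> u * norm (x - p) + v * norm (y - q)"
      using uv norm_triangle_ineq[of "u *\<^sub>R (x - p)" "v *\<^sub>R (y - q)"] by simp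
    also have "\<dots> \<le> e + d"
      using uv pq by (intro convex_bound_le) (auto simp: dist_norm)
    finally show ?thesis
      using infdist_le[OF convexD[OF assms(1) pq(1,3) uv], of "u *\<^sub>R x + v *\<^sub>R y"]
      by (simp add: dist_norm)
  qed
  then show "u *\<^sub>R x + v *\<^sub>R y \<in> {x. infdist x S \<le> e}" by (auto intro: field_le_epsilon)
qed

lemma deformed_numerical_range_in_nonempty_compacts:
  fixes T :: "'a::complex_inner \<Rightarrow> 'a"
  assumes "(UNIV :: 'a set) \<noteq> {0}" "bounded_clinear T" "\<rho> \<in> {1..2}"
  shows "deformed_numerical_range \<rho> T \<in> nonempty_compacts"
proof -
  obtain x :: 'a where "x \<noteq> 0" using assms(1) by blast
  then have "sgn x \<in> def_dom \<rho> T" by (simp add: def_dom_eq_sphere[OF assms(3)] norm_sgn)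
  then show ?thesis
    using deformed_point_in_range[of "sgn x" \<rho> T] compact_deformed_numerical_range[OF assms(2)] assms(3)
    by (auto simp: nonempty_compacts_def)
qed

text \<open>Both domains are the whole unit sphere, so points of the same \<open>h\<close> are
  compared. The closed neighbourhood of a range is convex, so the bound passes from the points to
  the hull.\<close>

lemma hausdorff_dist_deformed_numerical_range_le:
  fixes T :: "'a::complex_inner \<Rightarrow> 'a"
  assumes "(UNIV :: 'a set) \<noteq> {0}" "bounded_clinear T" "\<rho> \<in> {1..2}" "\<sigma> \<in> {1..2}"
    and B: "\<And>h. norm h = 1 \<Longrightarrow> norm (T h) \<le> B"
  defines "d \<equiv> \<bar>def_radius \<rho> - def_radius \<sigma>\<bar>"
  shows "hausdorff_dist (deformed_numerical_range \<rho> T) (deformed_numerical_range \<sigma> T)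
    \<le> d * B + sqrt (6 * d) * B"
proof -
  note cpt = deformed_numerical_range_in_nonempty_compacts[OF assms(1,2)]
  have r: "def_radius \<tau> \<in> {0..1}" if "\<tau> \<in> {1..2}" for \<tau>
    using that def_radius_bounds[of \<tau>] def_radius_mono[of \<tau> 2] by (simp add: def_radius_2)
  have half: "infdist a (deformed_numerical_range \<tau>' T) \<le> d * B + sqrt (6 * d) * B"
    if \<tau>: "\<tau> \<in> {1..2}" "\<tau>' \<in> {1..2}" and d: "d = \<bar>def_radius \<tau> - def_radius \<tau>'\<bar>"
      and a: "a \<in> deformed_numerical_range \<tau> T" for \<tau> \<tau>' a
  proof -
    have "deformed_numerical_range \<tau> T \<subseteq> {a. infdist a (deformed_numerical_range \<tau>' T) \<le> d * B + sqrt (6 * d) * B}"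
    proof (rule deformed_numerical_range_subsetI)
      fix h assume "h \<in> def_dom \<tau> T"
      then have h: "norm h = 1" "h \<in> def_dom \<tau>' T"
        unfolding def_dom_eq_sphere[OF \<tau>(1)] def_dom_eq_sphere[OF \<tau>(2)] by auto
      have "cmod (deformed_point \<tau> T h - deformed_point \<tau>' T h)
        \<le> \<bar>larger_root (def_radius \<tau>) (cmod (cinner (T h) h)) (norm (T h))
          - larger_root (def_radius \<tau>') (cmod (cinner (T h) h)) (norm (T h))\<bar>"
        by (simp add: deformed_point_def norm_mult norm_sgn flip: left_diff_distrib of_real_diff)
      also have "\<dots> \<le> d * B + sqrt (6 * d) * B"
        unfolding d using r \<tau> B[OF h(1)] cmod_cinner_le_norm[OF h(1)]
        by (intro larger_root_modulus_of_continuity) auto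
      finally show "deformed_point \<tau> T h \<in> {a. infdist a (deformed_numerical_range \<tau>' T) \<le> d * B + sqrt (6 * d) * B}"
        using infdist_le[OF deformed_point_in_range[OF h(2)], of "deformed_point \<tau> T h"]
        by (simp add: dist_norm)
    next
      show "closed {a. infdist a (deformed_numerical_range \<tau>' T) \<le> d * B + sqrt (6 * d) * B}"
        by (intro closed_Collect_le continuous_intros)
    next
      show "convex {a. infdist a (deformed_numerical_range \<tau>' T) \<le> d * B + sqrt (6 * d) * B}"
        using cpt[OF \<tau>(2)] by (intro convex_infdist_le convex_deformed_numerical_range)
          (simp add: nonempty_compacts_def)
    qed
    with a show ?thesis by blast
  qed
  show ?thesis
    unfolding hausdorff_dist_le_iff[OF cpt[OF assms(3)] cpt[OF assms(4)]]
    using half[OF assms(3,4)] half[OF assms(4,3)] by (auto simp: d_def abs_minus_commute)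
qed

lemma continuous_map_deformed_numerical_range:
  fixes T :: "'a::complex_inner \<Rightarrow> 'a"
  assumes "(UNIV :: 'a set) \<noteq> {0}" "bounded_clinear T"
  shows "continuous_map (top_of_set {1..2}) (Metric_space.mtopology nonempty_compacts hausdorff_dist)
    (\<lambda>\<rho>. deformed_numerical_range \<rho> T)"
proof -
  interpret H: Metric_space "nonempty_compacts :: complex set set" hausdorff_dist
    by (rule Metric_space_hausdorff_dist)
  obtain B where B: "\<And>h. norm (T h) \<le> norm h * B"
    using assms(2) unfolding bounded_clinear_def by (metis bounded_linear.bounded)
  show ?thesis
    unfolding H.continuous_map_to_metric
  proof (intro ballI allI impI)
    fix \<rho> \<epsilon> :: real assume \<rho>: "\<rho> \<in> topspace (top_of_set {1..2})" and "\<epsilon> > 0"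
    \<comment> \<open>An explicit modulus, continuous and zero at \<open>\<sigma> = \<rho>\<close>;
      \<open>m < \<epsilon>\<close> cuts out the neighbourhood.\<close>
    define m where "m \<sigma> = \<bar>def_radius \<rho> - def_radius \<sigma>\<bar> * B + sqrt (6 * \<bar>def_radius \<rho> - def_radius \<sigma>\<bar>) * B" for \<sigma>
    have "continuous_on {1..2} m"
      unfolding m_def def_radius_def by (intro continuous_intros) auto
    then have "openin (top_of_set {1..2}) ({1..2} \<inter> m -` {..<\<epsilon>})"
      by (rule continuous_openin_preimage_gen) simp
    moreover have "\<rho> \<in> {1..2} \<inter> m -` {..<\<epsilon>}" using \<rho> \<open>\<epsilon> > 0\<close> by (simp add: m_def)
    moreover have "deformed_numerical_range \<sigma> T \<in> H.mball (deformed_numerical_range \<rho> T) \<epsilon>"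
      if "\<sigma> \<in> {1..2} \<inter> m -` {..<\<epsilon>}" for \<sigma>
    proof -
      have "hausdorff_dist (deformed_numerical_range \<rho> T) (deformed_numerical_range \<sigma> T) \<le> m \<sigma>"
        unfolding m_def using that \<rho> B
        by (intro hausdorff_dist_deformed_numerical_range_le[OF assms]) (auto, metis mult_1)
      with that show ?thesis
        using deformed_numerical_range_in_nonempty_compacts[OF assms] \<rho> by (simp add: H.in_mball)
    qed
    ultimately show "\<exists>U. openin (top_of_set {1..2}) U \<and> \<rho> \<in> U \<and>
        (\<forall>\<sigma>\<in>U. deformed_numerical_range \<sigma> T \<in> H.mball (deformed_numerical_range \<rho> T) \<epsilon>)"
      by blast
  qed
qed

subsection \<open>Strictness in finite dimension\<close>

text \<open>Gram-Schmidt, one vector at a time. The last clause is linear in \<open>b\<close>, so it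
  extends to the span of \<open>B\<close>.\<close>

lemma exists_orthonormal_expansion:
  fixes B :: "'a::complex_inner set"
  assumes "finite B"
  shows "\<exists>E. finite E \<and> (\<forall>e\<in>E. norm e = 1) \<and> (\<forall>e\<in>E. \<forall>f\<in>E. e \<noteq> f \<longrightarrow> cinner e f = 0) \<and>
    (\<forall>b\<in>B. (\<Sum>e\<in>E. cinner b e *\<^sub>C e) = b)"
  using assms
proof (induction B rule: finite_induct)
  case empty
  show ?case by (rule exI[of _ "{}"]) simp
next
  case (insert b B)
  then obtain E where E: "finite E" "\<And>e. e \<in> E \<Longrightarrow> norm e = 1"
      "\<And>e f. e \<in> E \<Longrightarrow> f \<in> E \<Longrightarrow> e \<noteq> f \<Longrightarrow> cinner e f = 0"
    and B: "\<And>x. x \<in> B \<Longrightarrow> (\<Sum>e\<in>E. cinner x e *\<^sub>C e) = x"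
    by metis
  define b' where "b' = b - (\<Sum>e\<in>E. cinner b e *\<^sub>C e)"
  have coeff: "cinner (\<Sum>e\<in>E. g e *\<^sub>C e) f = g f" if "f \<in> E" for g f
  proof -
    have "cinner (\<Sum>e\<in>E. g e *\<^sub>C e) f = (\<Sum>e\<in>E. if e = f then g f else 0)"
      unfolding cinner.sum_left
      by (rule sum.cong) (use that E in \<open>auto simp: cinner_scaleC_left cinner_self\<close>)
    then show ?thesis using E(1) that by simp
  qed
  show ?case
  proof (cases "b' = 0")
    case True
    then show ?thesis using E B by (intro exI[of _ E]) (auto simp: b'_def)
  next
    case False
    define e where "e = complex_of_real (1 / norm b') *\<^sub>C b'"
    have e: "norm e = 1" using False by (simp add: e_def norm_scaleC norm_divide)
    have b'E: "cinner b' f = 0" if "f \<in> E" for f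
      by (simp add: b'_def cinner.diff_left coeff that)
    then have eE: "cinner e f = 0" "cinner f e = 0" if "f \<in> E" for f
      using that cinner_commute[of f e] by (auto simp: e_def cinner_scaleC_left)
    then have "e \<notin> E" using e cinner_self[of e] by force
    have span_e: "cinner (\<Sum>f\<in>E. g f *\<^sub>C f) e = 0" for g
      by (simp add: cinner.sum_left cinner_scaleC_left eE)
    have "cinner b e = cinner b' e" by (simp add: b'_def cinner.diff_left span_e)
    then have "cinner b e *\<^sub>C e = b'"
      using False by (simp add: e_def cinner_scaleC_right cinner_self scaleC_scaleC scaleC_one power2_eq_square)
    then have "(\<Sum>f\<in>insert e E. cinner b f *\<^sub>C f) = b"
      using \<open>e \<notin> E\<close> E(1) by (simp add: b'_def)
    moreover have "(\<Sum>f\<in>insert e E. cinner x f *\<^sub>C f) = x" if "x \<in> B" for x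
    proof -
      have "cinner x e = 0" using span_e[of "cinner x"] B[OF that] by simp
      then show ?thesis using \<open>e \<notin> E\<close> E(1) B[OF that] by (simp add: scaleC.zero_left)
    qed
    ultimately show ?thesis
      using E e eE by (intro exI[of _ "insert e E"]) auto
  qed
qed

text \<open>Each new vector adds a continuous image of the closed unit disc times the compact set
  found before.\<close>

lemma compact_bounded_combinations:
  fixes E :: "'a::complex_inner set"
  assumes "finite E"
  shows "\<exists>C. compact C \<and> (\<forall>g. (\<forall>e\<in>E. cmod (g e) \<le> 1) \<longrightarrow> (\<Sum>e\<in>E. g e *\<^sub>C e) \<in> C)"
  using assms
proof (induction E rule: finite_induct)
  case empty
  show ?case by (rule exI[of _ "{0}"]) simp
next
  case (insert e E)
  then obtain C where C: "compact C" "\<And>g. \<forall>e\<in>E. cmod (g e) \<le> 1 \<Longrightarrow> (\<Sum>e\<in>E. g e *\<^sub>C e) \<in> C"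
    by blast
  have "compact ((\<lambda>p. fst p *\<^sub>C e + snd p) ` (cball 0 1 \<times> C))"
    using C(1) by (intro compact_continuous_image compact_Times compact_cball
        continuous_on_add scaleC.continuous_on continuous_on_fst continuous_on_snd continuous_on_id
        continuous_on_const)
  moreover have "(\<Sum>f\<in>insert e E. g f *\<^sub>C f) \<in> (\<lambda>p. fst p *\<^sub>C e + snd p) ` (cball 0 1 \<times> C)"
    if "\<forall>f\<in>insert e E. cmod (g f) \<le> 1" for g
  proof (rule image_eqI)
    show "(\<Sum>f\<in>insert e E. g f *\<^sub>C f) = fst (g e, \<Sum>f\<in>E. g f *\<^sub>C f) *\<^sub>C e + snd (g e, \<Sum>f\<in>E. g f *\<^sub>C f)"
      using insert.hyps by simp
    show "(g e, \<Sum>f\<in>E. g f *\<^sub>C f) \<in> cball 0 1 \<times> C" using that C(2)[of g] by simp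
  qed
  ultimately show ?case by (intro exI conjI allI impI)
qed

text \<open>By Cauchy-Schwarz a unit vector has orthonormal coefficients of modulus at most 1, so
  the sphere is a closed part of a compact set of combinations.\<close>

lemma compact_sphere_finite_dimensional:
  fixes B :: "'a::complex_inner set"
  assumes "finite_dimensional_vector_space scaleC B"
  shows "compact (sphere (0::'a) 1)"
proof -
  interpret fd: finite_dimensional_vector_space scaleC B by (rule assms)
  obtain E where E: "finite E" "\<forall>e\<in>E. norm e = 1"
    and B: "\<forall>b\<in>B. (\<Sum>e\<in>E. cinner b e *\<^sub>C e) = b"
    using exists_orthonormal_expansion[OF fd.finite_Basis] by (elim exE conjE)
  have "fd.span B \<subseteq> {x. (\<Sum>e\<in>E. cinner x e *\<^sub>C e) = x}"
  proof (rule fd.span_minimal)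
    show "fd.subspace {x. (\<Sum>e\<in>E. cinner x e *\<^sub>C e) = x}"
    proof (rule fd.subspaceI)
      fix x y assume "x \<in> {x. (\<Sum>e\<in>E. cinner x e *\<^sub>C e) = x}" "y \<in> {x. (\<Sum>e\<in>E. cinner x e *\<^sub>C e) = x}"
      then show "x + y \<in> {x. (\<Sum>e\<in>E. cinner x e *\<^sub>C e) = x}"
        by (simp add: cinner_add_left scaleC_add_left sum.distrib)
    next
      fix c x assume "x \<in> {x. (\<Sum>e\<in>E. cinner x e *\<^sub>C e) = x}"
      then have "c *\<^sub>C (\<Sum>e\<in>E. cinner x e *\<^sub>C e) = c *\<^sub>C x" by simp
      then show "c *\<^sub>C x \<in> {x. (\<Sum>e\<in>E. cinner x e *\<^sub>C e) = x}"
        by (simp add: scaleC.sum_right scaleC_scaleC cinner_scaleC_left)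
    qed (simp add: cinner.zero_left scaleC.zero_left)
  qed (use B in auto)
  then have expansion: "(\<Sum>e\<in>E. cinner x e *\<^sub>C e) = x" for x
    unfolding fd.span_Basis by auto
  obtain C where "compact C" and C: "\<And>g. \<forall>e\<in>E. cmod (g e) \<le> 1 \<Longrightarrow> (\<Sum>e\<in>E. g e *\<^sub>C e) \<in> C"
    using compact_bounded_combinations[OF E(1)] by blast
  have sub: "sphere 0 1 \<subseteq> C"
  proof
    fix x :: 'a assume "x \<in> sphere 0 1"
    then have "cmod (cinner x e) \<le> 1" if "e \<in> E" for e
      using cinner_Cauchy_Schwarz[of x e] E(2) that by simp
    then have "(\<Sum>e\<in>E. cinner x e *\<^sub>C e) \<in> C" by (intro C ballI)
    then show "x \<in> C" unfolding expansion .
  qed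
  have "closed {x :: 'a. dist 0 x = 1}" by (intro closed_Collect_eq continuous_intros)
  then have "compact (C \<inter> sphere 0 1)"
    unfolding sphere_def by (rule compact_Int_closed[OF \<open>compact C\<close>])
  then show ?thesis unfolding inf_absorb2[OF sub] .
qed

section \<open>Eigenvectors at support points\<close>

lemma continuous_on_larger_root_cinner:
  assumes "bounded_clinear T"
  shows "continuous_on UNIV (\<lambda>h. larger_root r (cmod (cinner (T h) h)) (norm (T h)))"
    and "continuous_on UNIV (\<lambda>h. cinner (T h) h)"
proof -
  have T: "continuous_on UNIV T"
    using assms by (simp add: bounded_clinear_def linear_continuous_on)
  then show *: "continuous_on UNIV (\<lambda>h. cinner (T h) h)"
    by (intro cinner.continuous_on continuous_on_id)
  show "continuous_on UNIV (\<lambda>h. larger_root r (cmod (cinner (T h) h)) (norm (T h)))"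
    unfolding larger_root_def by (intro continuous_intros T *) auto
qed

text \<open>Equality case of Cauchy-Schwarz: the squared distance from \<open>x\<close> to its
  projection on \<open>h\<close> is ||x||^2 - |<x,h>|^2. It is meant for
  \<open>x = T h\<close>.\<close>

lemma eigenvector_if_cmod_cinner_eq:
  assumes "norm h = 1" "cmod (cinner x h) = norm x"
  shows "x = cinner x h *\<^sub>C h"
proof -
  let ?z = "cinner x h"
  have h: "cinner h h = 1" using assms(1) cinner_self[of h] by simp
  have "complex_of_real ((norm (x - ?z *\<^sub>C h))\<^sup>2) = of_real ((norm x)\<^sup>2) - ?z * cnj ?z"
    unfolding cinner_self[symmetric] cinner.diff_left cinner.diff_right cinner_scaleC_left
      cinner_scaleC_right h cinner_commute[of h x]
    by (simp add: algebra_simps)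
  also have "\<dots> = 0" using assms(2) by (simp add: complex_norm_square[symmetric])
  finally show ?thesis by simp
qed

text \<open>First-order condition for a minimum at s = 0; s = -A / k with k > B refutes a nonzero
  slope.\<close>

lemma linear_coeff_zero_if_quadratic_nonneg:
  fixes A B :: real
  assumes "\<And>s. 0 \<le> s * A + s\<^sup>2 * B"
  shows "A = 0"
proof (rule ccontr)
  assume "A \<noteq> 0"
  define k where "k = \<bar>B\<bar> + 1"
  have k: "0 < k" "B < k" by (auto simp: k_def)
  define q where "q = A / k"
  have q: "A = q * k" "q \<noteq> 0" using k \<open>A \<noteq> 0\<close> by (simp_all add: q_def)
  have "(- q) * A + (- q)\<^sup>2 * B = q\<^sup>2 * (B - k)"
    unfolding q(1) by (simp add: power2_eq_square algebra_simps)
  also have "\<dots> < 0" using k q(2) by (intro mult_pos_neg) auto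
  finally show False using assms[of "- q"] by simp
qed

text \<open>
  The positive semidefinite Hermitian form \<open>M \<parallel>h\<parallel>\<^sup>2 - Re (c \<langle>Th,h\<rangle>)\<close> vanishes at \<open>u\<close>, hence \<open>u\<close> is
  orthogonal to everything with respect to it; on eigenvectors this gives orthogonality to \<open>u\<close>.
\<close>

lemma support_eigenvector_orthogonal:
  fixes T :: "'a::complex_inner \<Rightarrow> 'a"
  assumes T: "bounded_clinear T" and "c \<noteq> 0"
    and le: "\<And>h. norm h = 1 \<Longrightarrow> Re (c * cinner (T h) h) \<le> Re (c * \<alpha>)"
    and u: "norm u = 1" "T u = \<alpha> *\<^sub>C u" and v: "T v = \<beta> *\<^sub>C v" and "\<alpha> \<noteq> \<beta>"
  shows "cinner u v = 0"
proof -
  let ?M = "Re (c * \<alpha>)"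
  have form: "Re (c * cinner (T h) h) \<le> ?M * (norm h)\<^sup>2" for h
  proof (cases "h = 0")
    case False
    define k where "k = complex_of_real (1 / norm h) *\<^sub>C h"
    have k: "norm k = 1" using False by (simp add: k_def norm_scaleC norm_divide)
    have h: "h = complex_of_real (norm h) *\<^sub>C k"
      using False by (simp add: k_def scaleC_scaleC scaleC_one)
    have "cinner (T h) h = of_real ((norm h)\<^sup>2) * cinner (T k) k"
      by (subst (1 2) h)
        (simp add: bounded_clinear_scaleC[OF T] cinner_scaleC_left cinner_scaleC_right power2_eq_square)
    then have "Re (c * cinner (T h) h) = (norm h)\<^sup>2 * Re (c * cinner (T k) k)"
      by (simp add: algebra_simps)
    also have "\<dots> \<le> (norm h)\<^sup>2 * ?M" using le[OF k] by (intro mult_left_mono) auto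
    finally show ?thesis by (simp add: mult.commute)
  qed (simp add: cinner.zero_right)
  have key: "Re (cinner u w * cnj (c * (\<alpha> - \<beta>))) = 0" if w: "T w = \<beta> *\<^sub>C w" for w
  proof -
    let ?g = "cinner u w"
    \<comment> \<open>\<open>A\<close> and \<open>Q\<close> are the coefficients of the form at u +
      s w; the constant term is its value at \<open>u\<close>, namely 0.\<close>
    define A where "A = 2 * ?M * Re ?g - Re (c * \<alpha> * ?g + c * \<beta> * cnj ?g)"
    define Q where "Q = ?M * (norm w)\<^sup>2 - Re (c * \<beta>) * (norm w)\<^sup>2"
    have "0 \<le> s * A + s\<^sup>2 * Q" for s :: real
    proof -
      let ?h = "u + complex_of_real s *\<^sub>C w"
      note expand = cinner_add_left cinner_add_right cinner_scaleC_left cinner_scaleC_right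
        cinner_self_eq_1[OF u(1)] cinner_self[of w] cinner_commute[of w u]
      have "T ?h = \<alpha> *\<^sub>C u + (complex_of_real s * \<beta>) *\<^sub>C w"
        by (simp add: bounded_clinear_add[OF T] bounded_clinear_scaleC[OF T] u w scaleC_scaleC)
      then have Th: "cinner (T ?h) ?h
        = \<alpha> + of_real s * (\<alpha> * ?g + \<beta> * cnj ?g) + of_real (s\<^sup>2 * (norm w)\<^sup>2) * \<beta>"
        by (simp add: expand algebra_simps power2_eq_square)
      have "(norm ?h)\<^sup>2 = Re (cinner ?h ?h)" by (simp add: cinner_self)
      also have "cinner ?h ?h = 1 + of_real s * (?g + cnj ?g) + of_real (s\<^sup>2 * (norm w)\<^sup>2)"
        by (simp add: expand algebra_simps power2_eq_square)
      finally have hh: "(norm ?h)\<^sup>2 = 1 + s * (2 * Re ?g) + s\<^sup>2 * (norm w)\<^sup>2" by simp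
      have "?M * (norm ?h)\<^sup>2 - Re (c * cinner (T ?h) ?h) = s * A + s\<^sup>2 * Q"
        unfolding hh Th A_def Q_def by (simp add: algebra_simps)
      with form[of ?h] show ?thesis by simp
    qed
    then have "A = 0" by (rule linear_coeff_zero_if_quadratic_nonneg)
    moreover have "A = Re (?g * cnj (c * (\<alpha> - \<beta>)))" by (simp add: A_def algebra_simps)
    ultimately show ?thesis by simp
  qed
  \<comment> \<open>\<open>key\<close> controls only a real part. The eigenvector
    \<open>G *\<^sub>C v\<close> adjusts the phase and turns that part into |G|^2.\<close>
  define G where "G = cinner u v * cnj (c * (\<alpha> - \<beta>))"
  have "T (G *\<^sub>C v) = \<beta> *\<^sub>C (G *\<^sub>C v)"
    by (simp add: bounded_clinear_scaleC[OF T] v scaleC_scaleC mult.commute)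
  from key[OF this] have "Re (cnj G * G) = 0"
    by (simp add: cinner_scaleC_right G_def mult.assoc)
  then have "G = 0" by (simp add: complex_eq_iff sum_power2_eq_zero_iff flip: power2_eq_square)
  then show ?thesis using \<open>c \<noteq> 0\<close> \<open>\<alpha> \<noteq> \<beta>\<close> by (simp add: G_def)
qed

text \<open>
  A support point of \<open>W\<^bsup>\<rho>\<^sub>2\<^esup>(T)\<close> is a limit of deformed points of vectors \<open>h\<^sub>n\<close>; unless the limit of the
  \<open>h\<^sub>n\<close> is an eigenvector, the deformed points for \<open>\<rho>\<^sub>1\<close> of the same vectors reach beyond the support line.
\<close>

lemma support_point_eigenvalue:
  fixes T :: "'a::complex_inner \<Rightarrow> 'a"
  assumes cpt: "compact (sphere (0::'a) 1)" and T: "bounded_clinear T"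
    and \<rho>: "1 \<le> \<rho>\<^sub>1" "\<rho>\<^sub>1 < \<rho>\<^sub>2" "\<rho>\<^sub>2 \<le> 2"
    and eq: "deformed_numerical_range \<rho>\<^sub>1 T = deformed_numerical_range \<rho>\<^sub>2 T"
    and int: "0 \<in> interior (deformed_numerical_range \<rho>\<^sub>2 T)" and c: "cmod c = 1"
  obtains h \<alpha> where "norm h = 1" "T h = \<alpha> *\<^sub>C h"
    "\<And>w. w \<in> deformed_numerical_range \<rho>\<^sub>2 T \<Longrightarrow> Re (c * w) \<le> Re (c * \<alpha>)"
    "0 < Re (c * \<alpha>)"
proof -
  define a where "a h = cmod (cinner (T h) h)" for h
  define L where "L \<rho> h = larger_root (def_radius \<rho>) (a h) (norm (T h))" for \<rho> h
  let ?P = "deformed_point \<rho>\<^sub>2 T ` sphere 0 1"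
  have P: "deformed_point \<rho> T h = of_real (L \<rho> h) * sgn (cinner (T h) h)" for \<rho> h
    by (simp add: deformed_point_def L_def a_def)
  have dom: "def_dom \<rho>\<^sub>1 T = sphere 0 1" "def_dom \<rho>\<^sub>2 T = sphere 0 1"
    using \<rho> by (simp_all add: def_dom_eq_sphere)
  have "closure ?P \<noteq> {}" using int by (auto simp: deformed_numerical_range_eq dom)
  moreover have "compact (closure ?P)"
    using compact_closure_deformed_points[OF T, of \<rho>\<^sub>2] \<rho> by (simp add: dom)
  moreover have "continuous_on (closure ?P) (\<lambda>w. Re (c * w))" by (intro continuous_intros)
  ultimately obtain p where p: "p \<in> closure ?P" and max: "\<forall>w\<in>closure ?P. Re (c * w) \<le> Re (c * p)"
    using continuous_attains_sup by metis
  have support: "Re (c * w) \<le> Re (c * p)" if "w \<in> deformed_numerical_range \<rho>\<^sub>2 T" for w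
  proof -
    have half: "{w. Re (c * w) \<le> Re (c * p)} = {w. inner (cnj c) w \<le> Re (c * p)}"
      by (simp add: inner_complex_def)
    have "deformed_numerical_range \<rho>\<^sub>2 T \<subseteq> {w. Re (c * w) \<le> Re (c * p)}"
    proof (rule deformed_numerical_range_subsetI)
      fix h assume "h \<in> def_dom \<rho>\<^sub>2 T"
      then show "deformed_point \<rho>\<^sub>2 T h \<in> {w. Re (c * w) \<le> Re (c * p)}"
        using max closure_subset[of ?P] unfolding dom by blast
    qed (unfold half, simp_all only: closed_halfspace_le convex_halfspace_le)
    with that show ?thesis by blast
  qed
  \<comment> \<open>A small ball around 0 in the range contains a positive multiple of
    \<open>cnj c\<close>.\<close>
  have pos: "0 < Re (c * p)"
  proof -
    obtain e where "e > 0" "cball 0 e \<subseteq> deformed_numerical_range \<rho>\<^sub>2 T"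
      using int by (auto simp: mem_interior_cball)
    then have "of_real e * cnj c \<in> deformed_numerical_range \<rho>\<^sub>2 T"
      using c by (auto simp: norm_mult)
    moreover have "c * (of_real e * cnj c) = of_real e"
      using c by (simp add: mult.left_commute complex_norm_square[symmetric])
    ultimately show ?thesis using support \<open>e > 0\<close> by (metis Re_complex_of_real less_le_trans)
  qed
  obtain q where q: "\<And>n. q n \<in> ?P" "q \<longlonglongrightarrow> p" using p closure_sequential[of p ?P] by auto
  then have "\<forall>n. \<exists>x\<in>sphere 0 1. q n = deformed_point \<rho>\<^sub>2 T x" by blast
  then obtain x where x: "\<And>n. x n \<in> sphere 0 1" "\<And>n. q n = deformed_point \<rho>\<^sub>2 T (x n)" by metis
  obtain h \<phi> where h: "h \<in> sphere 0 1" and \<phi>: "strict_mono (\<phi> :: nat \<Rightarrow> nat)"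
    and lim: "(x \<circ> \<phi>) \<longlonglongrightarrow> h"
    using cpt x(1) unfolding compact_def by metis
  define y where "y n = x (\<phi> n)" for n
  have y: "\<And>n. norm (y n) = 1" "y \<longlonglongrightarrow> h" using x(1) lim by (auto simp: y_def[abs_def] o_def)
  have qlim: "(\<lambda>n. deformed_point \<rho>\<^sub>2 T (y n)) \<longlonglongrightarrow> p"
    using LIMSEQ_subseq_LIMSEQ[OF q(2) \<phi>] by (simp add: o_def x(2) y_def)
  have Llim: "(\<lambda>n. L \<rho> (y n)) \<longlonglongrightarrow> L \<rho> h" for \<rho>
    using continuous_on_tendsto_compose[OF continuous_on_larger_root_cinner(1)[OF T] y(2)]
    by (simp add: L_def a_def)
  have "h \<in> def_dom \<rho>\<^sub>2 T" "\<And>n. y n \<in> def_dom \<rho>\<^sub>2 T" using h y by (auto simp: dom)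
  then have D: "0 \<le> def_discr \<rho>\<^sub>2 T h" "\<And>n. 0 \<le> def_discr \<rho>\<^sub>2 T (y n)"
    using def_domD(2) \<rho> by (metis less_imp_le order_trans)+
  note r = def_radius_bounds[of \<rho>\<^sub>1] def_radius_bounds[of \<rho>\<^sub>2] def_radius_strict_mono[of \<rho>\<^sub>1 \<rho>\<^sub>2]
  \<comment> \<open>The two points of \<open>y n\<close> share a ray, so exchanging the roots
    exchanges the points; equality of the ranges puts the point for \<open>\<rho>\<^sub>1\<close>
    behind the support line. The product form passes to the limit without dividing or using
    continuity of \<open>sgn\<close>.\<close>
  have step: "L \<rho>\<^sub>1 (y n) * Re (c * deformed_point \<rho>\<^sub>2 T (y n)) \<le> L \<rho>\<^sub>2 (y n) * Re (c * p)" for n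
  proof -
    have "L \<rho>\<^sub>1 (y n) * Re (c * deformed_point \<rho>\<^sub>2 T (y n))
        = L \<rho>\<^sub>2 (y n) * Re (c * deformed_point \<rho>\<^sub>1 T (y n))"
      by (simp add: P algebra_simps)
    also have "\<dots> \<le> L \<rho>\<^sub>2 (y n) * Re (c * p)"
    proof (rule mult_left_mono)
      show "Re (c * deformed_point \<rho>\<^sub>1 T (y n)) \<le> Re (c * p)"
        using support deformed_point_in_range[of "y n" \<rho>\<^sub>1 T] y(1) by (simp add: eq dom)
      show "0 \<le> L \<rho>\<^sub>2 (y n)" unfolding L_def
        using D(2)[of n] r \<rho> by (intro larger_root_nonneg) (auto simp: def_discr_def a_def)
    qed
    finally show ?thesis .
  qed
  have "L \<rho>\<^sub>1 h * Re (c * p) \<le> L \<rho>\<^sub>2 h * Re (c * p)"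
    by (rule LIMSEQ_le[OF tendsto_mult[OF Llim tendsto_Re[OF tendsto_mult_left[OF qlim]]]
          tendsto_mult_right[OF Llim]]) (use step in blast)
  then have LL: "L \<rho>\<^sub>1 h \<le> L \<rho>\<^sub>2 h" using pos by simp
  have "\<not> a h < norm (T h)"
  proof
    assume "a h < norm (T h)"
    then have "L \<rho>\<^sub>2 h < L \<rho>\<^sub>1 h"
      unfolding L_def using r \<rho> D(1) by (intro larger_root_strict_antimono) (auto simp: a_def def_discr_def)
    with LL show False by simp
  qed
  then have a: "a h = norm (T h)" using cmod_cinner_le_norm[of h T] h by (simp add: a_def)
  then have L2: "L \<rho>\<^sub>2 h = norm (T h)" using r \<rho> by (simp add: L_def larger_root_diagonal)
  \<comment> \<open>A nonzero limit radius keeps <Th,h> away from 0, where \<open>sgn\<close> is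
    discontinuous, so \<open>p\<close> can be identified.\<close>
  have "L \<rho>\<^sub>2 h \<noteq> 0"
  proof
    assume "L \<rho>\<^sub>2 h = 0"
    then have "(\<lambda>n. deformed_point \<rho>\<^sub>2 T (y n)) \<longlonglongrightarrow> 0"
      by (intro Lim_null_comparison[OF _ Llim[of \<rho>\<^sub>2, THEN tendsto_rabs, simplified, unfolded \<open>L \<rho>\<^sub>2 h = 0\<close> abs_zero]])
        (simp add: P norm_mult norm_sgn)
    then have "p = 0" using qlim LIMSEQ_unique by blast
    then show False using pos by simp
  qed
  then have z: "cinner (T h) h \<noteq> 0" using a L2 by (auto simp: a_def)
  have "(\<lambda>n. cinner (T (y n)) (y n)) \<longlonglongrightarrow> cinner (T h) h"
    using continuous_on_tendsto_compose[OF continuous_on_larger_root_cinner(2)[OF T] y(2)] by simp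
  then have "(\<lambda>n. deformed_point \<rho>\<^sub>2 T (y n)) \<longlonglongrightarrow> of_real (L \<rho>\<^sub>2 h) * sgn (cinner (T h) h)"
    unfolding P by (intro tendsto_mult tendsto_of_real Llim tendsto_sgn z)
  then have "p = of_real (a h) * sgn (cinner (T h) h)" using qlim LIMSEQ_unique a L2 by metis
  then have "p = cinner (T h) h" using z by (simp add: a_def sgn_eq)
  then show thesis
    using that[of h p] support pos eigenvector_if_cmod_cinner_eq[of h "T h"] h a by (simp add: a_def)
qed

section \<open>Finiteness and uniqueness of supporting eigenvalues\<close>

lemma orthonormal_dist_ge:
  assumes "norm u = 1" "norm v = 1" "cinner u v = 0"
  shows "1 \<le> dist u v"
proof -
  have "(norm (u - v))\<^sup>2 = 2"
    using assms by (simp add: power2_norm_eq_inner inner_diff_left inner_diff_right inner_commute[of v u]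
        inner_eq_Re_cinner[of u v] norm_eq_1)
  then show ?thesis using power2_le_imp_le[of 1 "norm (u - v)"] by (simp add: dist_norm)
qed

text \<open>An infinite \<open>U\<close> would have a limit point, and the ball of radius d / 2
  around it would hold two points of \<open>U\<close> less than \<open>d\<close> apart.\<close>

lemma finite_if_uniformly_separated:
  fixes U :: "'a::metric_space set"
  assumes "compact K" "U \<subseteq> K" "d > 0" "\<And>u v. u \<in> U \<Longrightarrow> v \<in> U \<Longrightarrow> u \<noteq> v \<Longrightarrow> d \<le> dist u v"
  shows "finite U"
proof (rule ccontr)
  assume "infinite U"
  then obtain x where x: "x islimpt U" using Heine_Borel_imp_Bolzano_Weierstrass[OF assms(1) _ assms(2)] by blast
  let ?X = "U \<inter> ball x (d/2)"
  have inf: "infinite ?X" using x assms(3) by (auto simp: islimpt_eq_infinite_ball)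
  then obtain u where u: "u \<in> ?X" using infinite_imp_nonempty by blast
  obtain v where "v \<in> ?X - {u}" using infinite_imp_nonempty[OF infinite_remove[OF inf]] by blast
  with u have "u \<in> U" "v \<in> U" "u \<noteq> v" "dist x u < d/2" "dist x v < d/2" by auto
  then show False using assms(4)[of u v] dist_triangle_half_r[of x u d v] by force
qed

text \<open>At \<open>\<rho> = 2\<close> the radius is 1 and the larger root is |<Th,h>|
  itself.\<close>

lemma numerical_range_subset: "numerical_range T \<subseteq> deformed_numerical_range 2 T"
proof
  fix w assume "w \<in> numerical_range T"
  then obtain h where "norm h = 1" "w = cinner (T h) h" by (auto simp: numerical_range_def)
  moreover from this have "deformed_point 2 T h = w"
    by (simp add: deformed_point_def def_radius_2 larger_root_1 sgn_eq)
  ultimately show "w \<in> deformed_numerical_range 2 T"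
    using deformed_point_in_range[of h 2 T] by (simp add: def_dom_def)
qed

text \<open>For the normalised sum \<open>h\<close> of the two eigenvectors, <Th,h> is the midpoint
  of the eigenvalues and lies on the support line. There |<Th,h>| < ||Th||, so for
  \<open>\<rho> < 2\<close> the deformed point is pushed beyond that line.\<close>

lemma two_support_eigenvalues_eq:
  fixes T :: "'a::complex_inner \<Rightarrow> 'a"
  assumes T: "bounded_clinear T" and \<rho>: "1 \<le> \<rho>" "\<rho> < 2"
    and W: "numerical_range T \<subseteq> deformed_numerical_range \<rho> T"
    and c: "0 < Re (c * \<alpha>)"
    and u: "norm u = 1" "T u = \<alpha> *\<^sub>C u" and v: "norm v = 1" "T v = \<beta> *\<^sub>C v"
    and max: "\<And>w. w \<in> deformed_numerical_range \<rho> T \<Longrightarrow> Re (c * w) \<le> Re (c * \<alpha>)"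
      "\<And>w. w \<in> deformed_numerical_range \<rho> T \<Longrightarrow> Re (c * w) \<le> Re (c * \<beta>)"
  shows "\<alpha> = \<beta>"
proof (rule ccontr)
  assume "\<alpha> \<noteq> \<beta>"
  have W': "cinner (T h) h \<in> deformed_numerical_range \<rho> T" if "norm h = 1" for h
    using W that by (auto simp: numerical_range_def)
  have uv: "cinner u v = 0"
    using support_eigenvector_orthogonal[OF T _ _ u v(2) \<open>\<alpha> \<noteq> \<beta>\<close>, of c] c max(1) W' by fastforce
  then have vu: "cinner v u = 0" using cinner_commute[of v u] by simp
  have "cinner (T u) u = \<alpha>" "cinner (T v) v = \<beta>"
    using u v by (simp_all add: cinner_scaleC_left cinner_self)
  then have same: "Re (c * \<beta>) = Re (c * \<alpha>)" using max W' u v by (metis order_antisym)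
  define h where "h = complex_of_real (1 / sqrt 2) *\<^sub>C (u + v)"
  note expand = cinner_add_left cinner_add_right cinner_scaleC_left cinner_scaleC_right
    cinner_self_eq_1[OF u(1)] cinner_self_eq_1[OF v(1)] uv vu
  have Th: "T h = complex_of_real (1 / sqrt 2) *\<^sub>C (\<alpha> *\<^sub>C u + \<beta> *\<^sub>C v)"
    by (simp add: h_def bounded_clinear_add[OF T] bounded_clinear_scaleC[OF T] u v)
  have half: "complex_of_real (1 / sqrt 2) * complex_of_real (1 / sqrt 2) = 1 / 2"
    by (simp flip: of_real_mult)
  have "complex_of_real ((norm h)\<^sup>2) = 1"
    unfolding cinner_self[symmetric] h_def expand using half by (simp add: algebra_simps)
  then have h: "norm h = 1" using norm_ge_zero[of h] by (metis of_real_eq_1_iff power2_eq_1_iff abs_1 abs_norm_cancel abs_minus_cancel)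
  have z: "cinner (T h) h = (\<alpha> + \<beta>) / 2"
    unfolding Th unfolding h_def expand using half by (simp add: algebra_simps)
  have "complex_of_real ((norm (T h))\<^sup>2) = of_real (((cmod \<alpha>)\<^sup>2 + (cmod \<beta>)\<^sup>2) / 2)"
    unfolding cinner_self[symmetric] Th expand using half by (simp add: complex_norm_square algebra_simps del: of_real_power)
  then have t: "(norm (T h))\<^sup>2 = ((cmod \<alpha>)\<^sup>2 + (cmod \<beta>)\<^sup>2) / 2" by (simp only: of_real_eq_iff)
  \<comment> \<open>The gap between the two squares compared next is a quarter of this.\<close>
  have "0 < (cmod (\<alpha> - \<beta>))\<^sup>2" using \<open>\<alpha> \<noteq> \<beta>\<close> by simp
  then have "(cmod (cinner (T h) h))\<^sup>2 < (norm (T h))\<^sup>2"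
    unfolding t z cmod_power2 by (simp add: power2_eq_square field_simps)
  then have lt: "cmod (cinner (T h) h) < norm (T h)" by (rule power2_less_imp_less) simp
  let ?x = "larger_root (def_radius \<rho>) (cmod (cinner (T h) h)) (norm (T h))"
  have x: "cmod (cinner (T h) h) < ?x"
    using larger_root_strict_antimono[OF def_radius_bounds(1)[OF \<rho>(1)] def_radius_strict_mono[OF \<rho>, unfolded def_radius_2] _ _ lt]
    by (simp add: larger_root_1)
  have M: "Re (c * cinner (T h) h) = Re (c * \<alpha>)"
    using same by (simp add: z field_simps)
  then have nz: "cinner (T h) h \<noteq> 0" using c by auto
  have "Re (c * deformed_point \<rho> T h) = ?x / cmod (cinner (T h) h) * Re (c * cinner (T h) h)"
    by (simp add: deformed_point_def sgn_eq algebra_simps diff_divide_distrib)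
  also have "\<dots> > 1 * Re (c * \<alpha>)"
    unfolding M using c x nz by (intro mult_strict_right_mono) auto
  finally show False
    using max(1)[OF deformed_point_in_range, of h] h \<rho> by (simp add: def_dom_eq_sphere)
qed

text \<open>
  If the two ranges agreed, every direction \<open>c\<close> of the unit circle would be supported at exactly one
  eigenvalue; the finitely many closed sets of directions belonging to the same eigenvalue are disjoint,
  so by connectedness one eigenvalue would be extremal in opposite directions.
\<close>

lemma deformed_numerical_range_neq:
  fixes T :: "'a::complex_inner \<Rightarrow> 'a"
  assumes fd: "finite_dimensional_vector_space scaleC (B :: 'a set)" and T: "bounded_clinear T"
    and \<rho>: "1 \<le> \<rho>\<^sub>1" "\<rho>\<^sub>1 < \<rho>\<^sub>2" "\<rho>\<^sub>2 < 2"
    and W: "numerical_range T \<subseteq> deformed_numerical_range \<rho>\<^sub>2 T"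
    and int: "0 \<in> interior (deformed_numerical_range \<rho>\<^sub>2 T)"
  shows "deformed_numerical_range \<rho>\<^sub>1 T \<noteq> deformed_numerical_range \<rho>\<^sub>2 T"
proof
  assume eq: "deformed_numerical_range \<rho>\<^sub>1 T = deformed_numerical_range \<rho>\<^sub>2 T"
  let ?K = "deformed_numerical_range \<rho>\<^sub>2 T"
  have cpt: "compact (sphere (0::'a) 1)" by (rule compact_sphere_finite_dimensional[OF fd])
  \<comment> \<open>\<open>D \<alpha>\<close> collects the directions supported at
    \<open>\<alpha>\<close>.\<close>
  define D where "D \<alpha> = {c \<in> sphere 0 1. \<forall>w\<in>?K. Re (c * w) \<le> Re (c * \<alpha>)}" for \<alpha>
  define \<Lambda> where "\<Lambda> = {\<alpha>. (\<exists>u. norm u = 1 \<and> T u = \<alpha> *\<^sub>C u) \<and> D \<alpha> \<noteq> {}}"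
  have W': "cinner (T h) h \<in> ?K" if "norm h = 1" for h
    using W that by (auto simp: numerical_range_def)
  have cover: "\<exists>\<alpha>\<in>\<Lambda>. c \<in> D \<alpha> \<and> 0 < Re (c * \<alpha>)" if "c \<in> sphere 0 1" for c
  proof -
    have "cmod c = 1" using that by simp
    then obtain h \<alpha> where "norm h = 1" "T h = \<alpha> *\<^sub>C h" "\<And>w. w \<in> ?K \<Longrightarrow> Re (c * w) \<le> Re (c * \<alpha>)"
      "0 < Re (c * \<alpha>)"
      using support_point_eigenvalue[OF cpt T \<rho>(1,2) less_imp_le[OF \<rho>(3)] eq int] by metis
    with that show ?thesis by (intro bexI[of _ \<alpha>]) (auto simp: \<Lambda>_def D_def)
  qed
  have disjoint: "\<alpha> = \<beta>" if "\<alpha> \<in> \<Lambda>" "\<beta> \<in> \<Lambda>" "c \<in> D \<alpha>" "c \<in> D \<beta>" for c \<alpha> \<beta>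
  proof -
    have c: "c \<in> sphere 0 1" using that by (simp add: D_def)
    \<comment> \<open>Positivity of the support value is known for the eigenvalue
      \<open>\<nu>\<close> given by \<open>cover\<close>, so both eigenvalues are compared with
      it.\<close>
    obtain \<nu> where \<nu>: "\<nu> \<in> \<Lambda>" "c \<in> D \<nu>" "0 < Re (c * \<nu>)" using cover[OF c] by blast
    have "\<nu> = \<kappa>" if \<kappa>: "\<kappa> \<in> \<Lambda>" "c \<in> D \<kappa>" for \<kappa>
    proof -
      obtain u v where "norm u = 1" "T u = \<nu> *\<^sub>C u" "norm v = 1" "T v = \<kappa> *\<^sub>C v"
        using \<nu>(1) \<kappa>(1) by (auto simp: \<Lambda>_def)
      then show ?thesis
        using two_support_eigenvalues_eq[OF T _ \<rho>(3) W \<nu>(3)] \<rho> \<nu>(2) \<kappa>(2) by (auto simp: D_def)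
    qed
    with that show ?thesis by metis
  qed
  have "finite \<Lambda>"
  proof -
    have "\<forall>\<alpha>\<in>\<Lambda>. \<exists>u. norm u = 1 \<and> T u = \<alpha> *\<^sub>C u" by (auto simp: \<Lambda>_def)
    then obtain u where u: "\<And>\<alpha>. \<alpha> \<in> \<Lambda> \<Longrightarrow> norm (u \<alpha>) = 1" "\<And>\<alpha>. \<alpha> \<in> \<Lambda> \<Longrightarrow> T (u \<alpha>) = \<alpha> *\<^sub>C u \<alpha>"
      by metis
    have sep: "1 \<le> dist (u \<alpha>) (u \<beta>)" if \<alpha>: "\<alpha> \<in> \<Lambda>" "\<beta> \<in> \<Lambda>" "\<alpha> \<noteq> \<beta>" for \<alpha> \<beta>
    proof -
      obtain c where c: "c \<in> D \<alpha>" using \<alpha>(1) by (auto simp: \<Lambda>_def)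
      then have "c \<noteq> 0" "\<And>h. norm h = 1 \<Longrightarrow> Re (c * cinner (T h) h) \<le> Re (c * \<alpha>)"
        using W' by (auto simp: D_def)
      then have "cinner (u \<alpha>) (u \<beta>) = 0"
        using support_eigenvector_orthogonal[OF T _ _ u(1,2)[OF \<alpha>(1)] u(2)[OF \<alpha>(2)] \<alpha>(3)] by blast
      then show ?thesis using orthonormal_dist_ge u(1) that by blast
    qed
    have "inj_on u \<Lambda>" using sep by (intro inj_onI) fastforce
    moreover have "finite (u ` \<Lambda>)"
      by (rule finite_if_uniformly_separated[OF cpt _ zero_less_one]) (use u(1) sep in auto)
    ultimately show ?thesis using finite_imageD by blast
  qed
  have closed: "closed (D \<alpha>)" for \<alpha>
  proof -
    have "D \<alpha> = sphere 0 1 \<inter> (\<Inter>w\<in>?K. {c. Re (c * w) \<le> Re (c * \<alpha>)})" by (auto simp: D_def)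
    then show ?thesis by (auto intro!: closed_Int closed_INT closed_Collect_le continuous_intros)
  qed
  have "connected (sphere (0::complex) 1)" by (rule connected_sphere) simp
  obtain \<alpha> where \<alpha>: "\<alpha> \<in> \<Lambda>" "1 \<in> D \<alpha>" "0 < Re (1 * \<alpha>)" using cover[of 1] by auto
  have "sphere 0 1 - D \<alpha> = (\<Union>\<beta>\<in>\<Lambda> - {\<alpha>}. D \<beta>)"
    using cover disjoint \<alpha>(1) by (fastforce simp: D_def)
  then have "closed (sphere 0 1 - D \<alpha>)" using \<open>finite \<Lambda>\<close> closed by auto
  moreover have "D \<alpha> \<subseteq> sphere 0 1" by (auto simp: D_def)
  ultimately have "sphere 0 1 - D \<alpha> = {}"
    using \<open>connected (sphere 0 1)\<close>[unfolded connected_closed] closed[of \<alpha>] \<alpha>(2) by blast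
  \<comment> \<open>The direction opposite to 1 is supported at the same \<open>\<alpha>\<close>;
    testing it at 0 gives Re \<alpha> <= 0.\<close>
  then have "- 1 \<in> D \<alpha>" by auto
  moreover have "0 \<in> ?K" using int interior_subset by blast
  ultimately show False using \<alpha>(3) by (force simp: D_def)
qed

theorem theorem15:
  fixes T :: "'a::complex_hilbert_space \<Rightarrow> 'a"
  assumes nontrivial: "(UNIV :: 'a set) \<noteq> {0}"
    and T: "bounded_clinear T"
  shows "(\<forall>\<rho>\<^sub>1 \<rho>\<^sub>2. 1 \<le> \<rho>\<^sub>1 \<and> \<rho>\<^sub>1 \<le> \<rho>\<^sub>2 \<and> 0 \<in> deformed_numerical_range \<rho>\<^sub>1 T \<longrightarrow>
            deformed_numerical_range \<rho>\<^sub>2 T \<subseteq> deformed_numerical_range \<rho>\<^sub>1 T)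
       \<and> (\<forall>\<rho>\<^sub>1 \<rho>\<^sub>2. 1 \<le> \<rho>\<^sub>1 \<and> \<rho>\<^sub>1 \<le> \<rho>\<^sub>2 \<and> 0 \<in> interior (deformed_numerical_range \<rho>\<^sub>2 T) \<longrightarrow>
            deformed_numerical_range \<rho>\<^sub>2 T \<subseteq> deformed_numerical_range \<rho>\<^sub>1 T)
       \<and> ((\<exists>B :: 'a set. finite_dimensional_vector_space scaleC B) \<longrightarrow>
            (\<forall>\<rho>\<^sub>1 \<rho>\<^sub>2. 1 \<le> \<rho>\<^sub>1 \<and> \<rho>\<^sub>1 < \<rho>\<^sub>2 \<and> \<rho>\<^sub>2 < 2 \<and> 0 \<in> interior (numerical_range T) \<longrightarrow>
              deformed_numerical_range \<rho>\<^sub>2 T \<subset> deformed_numerical_range \<rho>\<^sub>1 T))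
       \<and> continuous_map (top_of_set {1..2}) (Metric_space.mtopology nonempty_compacts hausdorff_dist)
            (\<lambda>\<rho>. deformed_numerical_range \<rho> T)"
proof -
  have interior_antimono: "deformed_numerical_range \<rho>\<^sub>2 T \<subseteq> deformed_numerical_range \<rho>\<^sub>1 T"
    if "1 \<le> \<rho>\<^sub>1" "\<rho>\<^sub>1 \<le> \<rho>\<^sub>2" "0 \<in> interior (deformed_numerical_range \<rho>\<^sub>2 T)" for \<rho>\<^sub>1 \<rho>\<^sub>2
    using deformed_numerical_range_antimono[OF T] zero_in_deformed_numerical_range[OF T] that by blast
  have "deformed_numerical_range \<rho>\<^sub>2 T \<subset> deformed_numerical_range \<rho>\<^sub>1 T"
    if fd: "finite_dimensional_vector_space scaleC (B :: 'a set)"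
      and \<rho>: "1 \<le> \<rho>\<^sub>1" "\<rho>\<^sub>1 < \<rho>\<^sub>2" "\<rho>\<^sub>2 < 2" and int: "0 \<in> interior (numerical_range T)" for B \<rho>\<^sub>1 \<rho>\<^sub>2
  proof -
    \<comment> \<open>Part (ii) between \<open>\<rho>\<^sub>2\<close> and 2 moves the hypothesis
      from the numerical range to the range for \<open>\<rho>\<^sub>2\<close>.\<close>
    have "0 \<in> interior (deformed_numerical_range 2 T)"
      using int interior_mono[OF numerical_range_subset] by blast
    then have W: "numerical_range T \<subseteq> deformed_numerical_range \<rho>\<^sub>2 T"
      using interior_antimono[of \<rho>\<^sub>2 2] \<rho> numerical_range_subset by force
    then have int2: "0 \<in> interior (deformed_numerical_range \<rho>\<^sub>2 T)" using int interior_mono by blast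
    then have "deformed_numerical_range \<rho>\<^sub>2 T \<subseteq> deformed_numerical_range \<rho>\<^sub>1 T"
      using interior_antimono \<rho> by simp
    with deformed_numerical_range_neq[OF fd T \<rho> W int2] show ?thesis by blast
  qed
  then show ?thesis
    using deformed_numerical_range_antimono[OF T] interior_antimono
      continuous_map_deformed_numerical_range[OF nontrivial T] by blast
qed

end
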